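(* $$\int_{-1}^{0}\zeta_H(z;s)\,dz=0\quad\text{for any } s\in\mathbb{C}\setminus\{1\}.$$
   Context: $\zeta_H$ is the Hurwitz zeta function (called the "Hurewicz zeta function" in the source), a function of two complex variables $z_0$ and $s$, defined by $\zeta_H(z_0;s):=\sum_{n=1}^{\infty}(z_0+n)^{-s}$, where the sum is understood as a remainder Cesàro sum (at least for $z_0\notin\mathbb{Z}_{<0}$). It converges classically for $\mathrm{Re}(s)>1$; for fixed $z_0$, the remainder Cesàro sum gives its analytic continuation in $s$ to $\mathrm{Re}(s)\le 1$, $s\neq 1$. In particular $\zeta_H(0;s)=\zeta(s)$, the Riemann zeta function, for all $s\in\mathbb{C}\setminus\{1\}$. The remainder Cesàro sum is defined as follows. On the horizontal contour $\gamma(t)=z_0+t$, $t\ge 0$, write $t=k+\alpha$ with $k\in\mathbb{Z}_{\ge0}$, $0\le\alpha<1$, and form the partial-sum function $F(t)=\sum_{n=1}^{k}(z_0+n)^{-s}$. The sum has value $L$ if $F(t)=\sum_{j}a_j(\gamma(t))^{\rho_j}(\ln\gamma(t))^{m_j}+R(t)$ (a finite sum, with $a_j\in\mathbb{C}$, $\rho_j\in\mathbb{C}\setminus\{0\}$, $m_j\in\mathbb{Z}_{\ge0}$) where $P^N[R](t)\to L$ as $t\to\infty$ for some $N\in\mathbb{Z}_{\ge0}$, with $P[h](t)=\frac1t\int_0^t h(u)\,du$.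
   Formalization: For Re s ≥ 1 the integral diverges at z = −1; it is read there as the finite part: the integral from −1+ε to 0, minus finitely many terms aε^ρ(ln ε)^m with ρ ≠ 0, tends to 0 as ε → 0+. For Re s < 1 it is the ordinary integral. *)

theory Defs
  imports "HOL-Analysis.Analysis"
begin

text \<open>The finite sums \<open>\<Sum>\<^sub>j a\<^sub>j w\<^bsup>\<rho>\<^sub>j\<^esup> (ln w)\<^bsup>m\<^sub>j\<^esup>\<close> with all \<open>\<rho>\<^sub>j \<noteq> 0\<close> that are discarded in a
  remainder limit, given by the list of the triples \<open>(a\<^sub>j, \<rho>\<^sub>j, m\<^sub>j)\<close>.
  Powers and logarithms are principal branches.\<close>

definition power_log_terms :: "(complex \<times> complex \<times> nat) list \<Rightarrow> bool" where
  "power_log_terms ts \<longleftrightarrow> (\<forall>(a, \<rho>, m) \<in> set ts. \<rho> \<noteq> 0)"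

definition power_log_sum :: "(complex \<times> complex \<times> nat) list \<Rightarrow> complex \<Rightarrow> complex" where
  "power_log_sum ts w = (\<Sum>(a, \<rho>, m)\<leftarrow>ts. a * w powr \<rho> * Ln w ^ m)"

definition cesaro_mean :: "(real \<Rightarrow> complex) \<Rightarrow> real \<Rightarrow> complex" where
  "cesaro_mean h t = complex_of_real (1 / t) * integral {0..t} h"

text \<open>The integrability conditions say that \<open>P\<^bsup>N\<^esup>[h]\<close> is well defined; they are needed because
  \<^const>\<open>integral\<close> is \<open>0\<close> on functions that are not integrable.\<close>

definition has_cesaro_limit :: "(real \<Rightarrow> complex) \<Rightarrow> complex \<Rightarrow> bool" where
  "has_cesaro_limit h L \<longleftrightarrow>
     (\<exists>N::nat. (\<forall>k<N. \<forall>t>0. (cesaro_mean ^^ k) h integrable_on {0..t}) \<and>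
               (((cesaro_mean ^^ N) h) \<longlongrightarrow> L) at_top)"

definition hurwitz_partial_sum :: "complex \<Rightarrow> complex \<Rightarrow> real \<Rightarrow> complex" where
  "hurwitz_partial_sum z s t = (\<Sum>n = 1..nat \<lfloor>t\<rfloor>. (z + of_nat n) powr (- s))"

definition has_remainder_cesaro_sum :: "complex \<Rightarrow> complex \<Rightarrow> complex \<Rightarrow> bool" where
  "has_remainder_cesaro_sum z s L \<longleftrightarrow>
     (\<exists>ts. power_log_terms ts \<and>
        has_cesaro_limit
          (\<lambda>t. hurwitz_partial_sum z s t - power_log_sum ts (z + complex_of_real t)) L)"

definition hurwitz_zeta :: "complex \<Rightarrow> complex \<Rightarrow> complex" where
  "hurwitz_zeta z s = (THE L. has_remainder_cesaro_sum z s L)"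

text \<open>Since \<open>\<zeta>\<^sub>H(z;s)\<close> behaves like \<open>(z+1)\<^bsup>-s\<^esup>\<close> at \<open>z = -1\<close>, its integral over \<open>[-1,0]\<close>
  diverges if \<open>Re s \<ge> 1\<close> and then has to be read in the remainder sense as well: after discarding
  powers and logarithms of the distance \<open>\<epsilon>\<close> to the lower endpoint, as for the sums above,
  the integral over \<open>[a+\<epsilon>,b]\<close> tends to \<open>L\<close> (a Hadamard finite part).\<close>

definition has_remainder_integral :: "(real \<Rightarrow> complex) \<Rightarrow> complex \<Rightarrow> real \<Rightarrow> real \<Rightarrow> bool" where
  "has_remainder_integral f L a b \<longleftrightarrow>
     (\<forall>\<epsilon>. 0 < \<epsilon> \<and> \<epsilon> < b - a \<longrightarrow> f integrable_on {a + \<epsilon>..b}) \<and>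
     (\<exists>ts. power_log_terms ts \<and>
        ((\<lambda>\<epsilon>. integral {a + \<epsilon>..b} f - power_log_sum ts (complex_of_real \<epsilon>)) \<longlongrightarrow> L) (at_right 0))"

end

theory Submission
  imports Defs
begin

text \<open>
  The integral vanishes because \<open>\<zeta>\<^sub>H(z;s)\<close> has, in \<open>z\<close>, the antiderivative
  \<open>\<zeta>\<^sub>H(z;s-1) / (1-s)\<close>, and \<open>\<zeta>\<^sub>H(\<epsilon>-1;s-1) = \<epsilon>\<^bsup>1-s\<^esup> + \<zeta>\<^sub>H(\<epsilon>;s-1)\<close> since the first summand
  can be split off. The integral over \<open>[-1+\<epsilon>,0]\<close> is therefore
  \<open>(\<zeta>\<^sub>H(0;s-1) - \<zeta>\<^sub>H(\<epsilon>;s-1) - \<epsilon>\<^bsup>1-s\<^esup>) / (1-s)\<close>. By continuity at \<open>0\<close>, all that remains as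
  \<open>\<epsilon>\<close> tends to \<open>0\<close> is the pure power \<open>\<epsilon>\<^bsup>1-s\<^esup>\<close>, with exponent \<open>1 - s \<noteq> 0\<close>; it is
  discarded, and it tends to \<open>0\<close> by itself when \<open>Re s < 1\<close>. For \<open>s = 2\<close> the antiderivative has to
  be a logarithmic substitute. The corresponding lemmas are \<open>hurwitz_primitive_deriv\<close> and
  \<open>hurwitz_primitive_shift\<close>.

  To get there, the value of the remainder Cesaro sum must be known. By the
  Euler--Maclaurin formula (\<open>hurwitz_partial_sum_euler_maclaurin\<close>) the partial sum is
  \<open>(z+t)\<^bsup>1-s\<^esup> / (1-s)\<close> plus a constant, plus a sawtooth times \<open>(z+t)\<^bsup>-s\<^esup>\<close>, plus an integral
  of a sawtooth times \<open>(z+u)\<^bsup>-s-1\<^esup>\<close>. A periodic function of mean zero times a power is averaged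
  away by enough means (\<open>periodic_poly_powr_mean_limit\<close>), and repeated integration by parts
  shows that its integral has a generalised limit, holomorphic in \<open>z\<close>
  (\<open>powr_limit_pair_exists\<close>).

  That value is the only one, because a power-log sum without exponent \<open>0\<close> can have no
  generalised limit except \<open>0\<close>. The Euler operator \<open>\<theta> = w d/dw\<close> sends functions with a generalised
  limit to functions with generalised limit \<open>0\<close>; so the operators \<open>\<theta> - \<rho>\<close>, which
  annihilate the sum when applied often enough, multiply its limit by \<open>-\<rho> \<noteq> 0\<close>
  (\<open>mean_limit_power_log_sum\<close>).
\<close>

section \<open>Iterated means from 1\<close>

definition tail_integrable :: "(real \<Rightarrow> complex) \<Rightarrow> bool" where
  "tail_integrable h \<longleftrightarrow> (\<forall>t. h integrable_on {1..t})"

text \<open>Averages are started at \<open>1\<close>: there the shifted variable \<open>z + t\<close> stays in the right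
  half-plane when \<open>Re z > -1\<close>, so that powers and logarithms are smooth and every iterated
  mean is continuous.\<close>

definition tail_mean :: "(real \<Rightarrow> complex) \<Rightarrow> real \<Rightarrow> complex" where
  "tail_mean h t = complex_of_real (1 / t) * integral {1..t} h"

text \<open>The comments below call \<open>L\<close> a generalised limit of \<open>h\<close>, of order \<open>N\<close>.\<close>

fun mean_limit :: "nat \<Rightarrow> (real \<Rightarrow> complex) \<Rightarrow> complex \<Rightarrow> bool" where
  "mean_limit 0 h L \<longleftrightarrow> tail_integrable h \<and> (h \<longlongrightarrow> L) at_top"
| "mean_limit (Suc N) h L \<longleftrightarrow> tail_integrable h \<and> mean_limit N (tail_mean h) L"

lemma mean_limit_imp_tail_integrable: "mean_limit N h L \<Longrightarrow> tail_integrable h"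
  by (cases N) auto

lemma tail_integrable_cong:
  assumes "\<And>t. t \<ge> 1 \<Longrightarrow> f t = g t"
  shows "tail_integrable f \<longleftrightarrow> tail_integrable g"
  unfolding tail_integrable_def by (intro all_cong1 integrable_cong) (use assms in auto)

lemma mean_limit_cong:
  assumes "\<And>t. t \<ge> 1 \<Longrightarrow> f t = g t"
  shows "mean_limit N f L \<longleftrightarrow> mean_limit N g L"
  using assms
proof (induction N arbitrary: f g)
  case 0
  have "eventually (\<lambda>t. f t = g t) at_top"
    using eventually_ge_at_top[of "1::real"] by eventually_elim (use 0 in auto)
  then have "(f \<longlongrightarrow> L) at_top \<longleftrightarrow> (g \<longlongrightarrow> L) at_top"
    by (rule tendsto_cong)
  then show ?case using tail_integrable_cong[of f g] 0 by simp
next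
  case (Suc N)
  have "tail_mean f t = tail_mean g t" for t
    unfolding tail_mean_def using Suc.prems by (auto intro!: arg_cong2[where f="(*)"] integral_cong)
  then have "tail_mean f = tail_mean g" ..
  then show ?case using tail_integrable_cong[of f g] Suc.prems by simp
qed

lemma tail_integrable_continuous: "continuous_on {1..} h \<Longrightarrow> tail_integrable h"
  unfolding tail_integrable_def
  by (auto intro!: integrable_continuous_real elim: continuous_on_subset)

lemma tail_integrable_add: "tail_integrable f \<Longrightarrow> tail_integrable g \<Longrightarrow> tail_integrable (\<lambda>t. f t + g t)"
  unfolding tail_integrable_def by (auto intro: integrable_add)

lemma tail_integrable_cmult: "tail_integrable f \<Longrightarrow> tail_integrable (\<lambda>t. c * f t)"
  unfolding tail_integrable_def by (auto intro: integrable_on_mult_right)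

lemma continuous_on_tail_primitive:
  assumes "tail_integrable h"
  shows "continuous_on {1..} (\<lambda>t. integral {1..t} h)"
  unfolding continuous_on_eq_continuous_within
proof
  fix x :: real assume "x \<in> {1..}"
  have "continuous_on {1..x+1} (\<lambda>t. integral {1..t} h)"
    using assms unfolding tail_integrable_def by (intro indefinite_integral_continuous_1) auto
  then have "continuous (at x within {1..x+1}) (\<lambda>t. integral {1..t} h)"
    using \<open>x \<in> {1..}\<close> by (simp add: continuous_on_eq_continuous_within)
  moreover have "at x within {1..x+1} = at x within {1..}"
    by (rule at_within_nhd[of _ "{..<x+1}"]) auto
  ultimately show "continuous (at x within {1..}) (\<lambda>t. integral {1..t} h)" by simp
qed

lemma continuous_on_tail_mean: "tail_integrable h \<Longrightarrow> continuous_on {1..} (tail_mean h)"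
  unfolding tail_mean_def
  by (intro continuous_intros continuous_on_tail_primitive) auto

lemma tail_integrable_tail_mean: "tail_integrable h \<Longrightarrow> tail_integrable (tail_mean h)"
  by (rule tail_integrable_continuous[OF continuous_on_tail_mean])

lemma const_over_t_tendsto_0: "((\<lambda>t. c / complex_of_real t) \<longlongrightarrow> 0) at_top"
proof -
  have "((\<lambda>t. c * complex_of_real (1 / t)) \<longlongrightarrow> c * of_real 0) at_top"
    by (intro tendsto_mult tendsto_of_real tendsto_const
        tendsto_divide_0[OF tendsto_const filterlim_at_top_imp_at_infinity[OF filterlim_ident]])
  then show ?thesis by (simp add: field_simps)
qed

lemma tail_mean_tendsto_0:
  assumes h: "tail_integrable h" and lim: "(h \<longlongrightarrow> 0) at_top"
  shows "(tail_mean h \<longlongrightarrow> 0) at_top"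
proof (rule tendstoI)
  fix e :: real assume "e > 0"
  then have "eventually (\<lambda>t. dist (h t) 0 < e / 2) at_top"
    using lim by (intro tendstoD) auto
  then obtain a where a: "\<And>t. t \<ge> a \<Longrightarrow> norm (h t) < e / 2"
    unfolding eventually_at_top_linorder by auto
  define b where "b = max a 1"
  have b: "b \<ge> 1" "\<And>t. t \<ge> b \<Longrightarrow> norm (h t) < e / 2" using a by (auto simp: b_def)
  have "((\<lambda>t. integral {1..b} h / complex_of_real t) \<longlongrightarrow> 0) at_top"
    by (rule const_over_t_tendsto_0)
  then have "eventually (\<lambda>t. dist (integral {1..b} h / complex_of_real t) 0 < e / 2) at_top"
    using \<open>e > 0\<close> by (intro tendstoD) auto
  then show "eventually (\<lambda>t. dist (tail_mean h t) 0 < e) at_top"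
    using eventually_ge_at_top[of b]
  proof eventually_elim
    case (elim t)
    have t: "t \<ge> 1" "t \<ge> b" using elim b by auto
    have int: "h integrable_on {1..t}" using h by (auto simp: tail_integrable_def)
    have "norm (integral {b..t} h) \<le> integral {b..t} (\<lambda>_. e / 2)"
      by (rule integral_norm_bound_integral)
         (use b in \<open>auto intro: less_imp_le integrable_subinterval_real[OF int]\<close>)
    also have "\<dots> = e / 2 * (t - b)" using t by simp
    also have "\<dots> \<le> e / 2 * t" using \<open>e > 0\<close> b by simp
    finally have *: "norm (integral {b..t} h) / t \<le> e / 2" using t by (simp add: field_simps)
    have "tail_mean h t = integral {1..b} h / of_real t + integral {b..t} h / of_real t"
      unfolding tail_mean_def using Henstock_Kurzweil_Integration.integral_combine[OF b(1) t(2) int]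
      by (simp add: field_simps flip: add_divide_distrib)
    then have "norm (tail_mean h t) \<le> norm (integral {1..b} h / of_real t) + norm (integral {b..t} h) / t"
      using norm_triangle_ineq[of "integral {1..b} h / of_real t" "integral {b..t} h / of_real t"] t
      by (simp add: norm_divide)
    then show ?case using * elim(1) unfolding dist_norm diff_0_right by linarith
  qed
qed

lemma tail_mean_const: "t \<ge> 1 \<Longrightarrow> tail_mean (\<lambda>_. c) t = c - c / of_real t"
  by (simp add: tail_mean_def field_simps scaleR_conv_of_real)

lemma tail_mean_add:
  assumes "tail_integrable f" "tail_integrable g"
  shows "tail_mean (\<lambda>t. f t + g t) t = tail_mean f t + tail_mean g t"
  using assms unfolding tail_mean_def tail_integrable_def
  by (simp add: integral_add algebra_simps)

lemma tail_mean_cmult: "tail_mean (\<lambda>t. c * f t) t = c * tail_mean f t"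
  unfolding tail_mean_def by simp

lemma tail_mean_tendsto:
  assumes h: "tail_integrable h" and lim: "(h \<longlongrightarrow> L) at_top"
  shows "(tail_mean h \<longlongrightarrow> L) at_top"
proof -
  have c: "tail_integrable (\<lambda>_. - L)" by (intro tail_integrable_continuous) auto
  have "(tail_mean (\<lambda>t. h t + - L) \<longlongrightarrow> 0) at_top"
    using tendsto_add[OF lim tendsto_const[of "- L"]]
    by (intro tail_mean_tendsto_0 tail_integrable_add h c) auto
  then have "((\<lambda>t. tail_mean (\<lambda>t. h t + - L) t + L - L / of_real t) \<longlongrightarrow> 0 + L - 0) at_top"
    by (intro tendsto_intros const_over_t_tendsto_0)
  moreover have "eventually (\<lambda>t. tail_mean (\<lambda>t. h t + - L) t + L - L / of_real t = tail_mean h t) at_top"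
    using eventually_ge_at_top[of "1::real"]
    by eventually_elim (subst tail_mean_add[OF h c], simp add: tail_mean_const)
  ultimately show ?thesis using tendsto_cong by force
qed

lemma mean_limit_Suc: "mean_limit N h L \<Longrightarrow> mean_limit (Suc N) h L"
  by (induction N arbitrary: h) (auto intro: tail_mean_tendsto tail_integrable_tail_mean)

lemma mean_limit_mono: "mean_limit M h L \<Longrightarrow> M \<le> N \<Longrightarrow> mean_limit N h L"
  by (induction N) (auto simp del: mean_limit.simps simp: le_Suc_eq intro: mean_limit_Suc)

lemma mean_limit_of_tendsto: "tail_integrable h \<Longrightarrow> (h \<longlongrightarrow> L) at_top \<Longrightarrow> mean_limit N h L"
  using mean_limit_mono[of 0 h L N] by simp

lemma mean_limit_add:
  "mean_limit N f L \<Longrightarrow> mean_limit N g M \<Longrightarrow> mean_limit N (\<lambda>t. f t + g t) (L + M)"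
proof (induction N arbitrary: f g)
  case 0 then show ?case by (auto intro: tail_integrable_add tendsto_add)
next
  case (Suc N)
  then have "mean_limit N (\<lambda>t. tail_mean f t + tail_mean g t) (L + M)" by simp
  moreover have "(\<lambda>t. tail_mean f t + tail_mean g t) = tail_mean (\<lambda>t. f t + g t)"
    using Suc.prems by (intro ext) (simp add: tail_mean_add)
  ultimately show ?case using Suc.prems by (auto intro: tail_integrable_add)
qed

lemma mean_limit_cmult: "mean_limit N f L \<Longrightarrow> mean_limit N (\<lambda>t. c * f t) (c * L)"
proof (induction N arbitrary: f)
  case 0 then show ?case by (auto intro: tail_integrable_cmult tendsto_mult)
next
  case (Suc N)
  have "(\<lambda>t. c * tail_mean f t) = tail_mean (\<lambda>t. c * f t)"
    by (intro ext) (simp add: tail_mean_cmult)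
  moreover have "mean_limit N (\<lambda>t. c * tail_mean f t) (c * L)" using Suc by simp
  ultimately show ?case using Suc.prems by (simp add: tail_integrable_cmult)
qed

lemma mean_limit_const: "mean_limit N (\<lambda>_. c) c"
  by (intro mean_limit_of_tendsto tail_integrable_continuous) auto

lemma mean_limit_const_over: "mean_limit N (\<lambda>t. c / of_real t) 0"
  by (intro mean_limit_of_tendsto tail_integrable_continuous const_over_t_tendsto_0 continuous_intros) auto

lemma mean_limit_diff:
  "mean_limit N f L \<Longrightarrow> mean_limit N g M \<Longrightarrow> mean_limit N (\<lambda>t. f t - g t) (L - M)"
  using mean_limit_add[of N f L "\<lambda>t. (-1) * g t" "(-1) * M"] mean_limit_cmult[of N g M "-1"] by simp

text \<open>Means started at \<open>0\<close> and at \<open>1\<close> have the same limits, because the integral over \<open>[0,1]\<close>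
  contributes only a multiple of \<open>1 / t\<close>, a null function that all later means keep null. The
  induction needs the freedom of such a null function \<open>g\<close>. Integrability near \<open>0\<close> is
  demanded of the iterates of \<open>h\<close> only below \<open>N\<close>, exactly as in the definition of a
  Cesaro limit.\<close>

lemma cesaro_mean_tail_mean_iff:
  assumes "\<And>k t. k < N \<Longrightarrow> t > 0 \<Longrightarrow> (cesaro_mean ^^ k) h integrable_on {0..t}"
    and "tail_integrable f" "tail_integrable g" "(g \<longlongrightarrow> 0) at_top"
    and "\<And>t. t \<ge> 1 \<Longrightarrow> h t = f t + g t"
  shows "(((cesaro_mean ^^ N) h) \<longlongrightarrow> L) at_top \<longleftrightarrow> mean_limit N f L"
  using assms
proof (induction N arbitrary: h f g)
  case 0
  have ev: "eventually (\<lambda>t. h t = f t + g t) at_top"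
    using eventually_ge_at_top[of "1::real"] by eventually_elim (use 0 in auto)
  have "((\<lambda>t. f t + g t) \<longlongrightarrow> L) at_top \<longleftrightarrow> (f \<longlongrightarrow> L) at_top"
    using tendsto_add[OF _ 0(4), of f L] tendsto_diff[OF _ 0(4), of "\<lambda>t. f t + g t" L] by auto
  with tendsto_cong[OF ev] show ?case using 0 by simp
next
  case (Suc N)
  define c where "c = integral {0..1} h"
  have int: "h integrable_on {0..t}" if "t > 0" for t using Suc.prems(1)[of 0] that by auto
  have "(((cesaro_mean ^^ N) (cesaro_mean h)) \<longlongrightarrow> L) at_top \<longleftrightarrow> mean_limit N (tail_mean f) L"
  proof (rule Suc.IH)
    show "(cesaro_mean ^^ k) (cesaro_mean h) integrable_on {0..t}" if "k < N" "t > 0" for k t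
      using Suc.prems(1)[of "Suc k" t] that by (simp add: funpow_swap1)
    show "tail_integrable (tail_mean f)" by (intro tail_integrable_tail_mean Suc)
    show "tail_integrable (\<lambda>t. tail_mean g t + c / of_real t)"
      by (intro tail_integrable_add tail_integrable_tail_mean Suc tail_integrable_continuous
          continuous_intros) auto
    show "((\<lambda>t. tail_mean g t + c / of_real t) \<longlongrightarrow> 0) at_top"
      using tendsto_add[OF tail_mean_tendsto_0[OF Suc.prems(3,4)] const_over_t_tendsto_0[of c]] by simp
    show "cesaro_mean h t = tail_mean f t + (tail_mean g t + c / of_real t)" if t: "t \<ge> 1" for t
    proof -
      have "integral {0..t} h = c + integral {1..t} h"
        unfolding c_def using t int[of t] by (intro Henstock_Kurzweil_Integration.integral_combine[symmetric]) auto
      also have "integral {1..t} h = integral {1..t} (\<lambda>t. f t + g t)"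
        using Suc.prems(5) by (intro integral_cong) auto
      finally have "cesaro_mean h t = c / of_real t + tail_mean (\<lambda>t. f t + g t) t"
        using t unfolding cesaro_mean_def tail_mean_def by (simp add: field_simps)
      then show ?thesis using tail_mean_add[OF Suc.prems(2,3)] by simp
    qed
  qed
  moreover have "(cesaro_mean ^^ Suc N) h = (cesaro_mean ^^ N) (cesaro_mean h)"
    by (simp add: funpow_swap1)
  ultimately show ?case using Suc.prems(2) by (metis mean_limit.simps(2))
qed

text \<open>Local boundedness is what keeps the means integrable at \<open>0\<close>: a mean of a function which
  is merely integrable there, such as \<open>1 / (t (ln t)\<^sup>2)\<close>, need not be integrable again.\<close>

definition cesaro_regular :: "(real \<Rightarrow> complex) \<Rightarrow> bool" where
  "cesaro_regular h \<longleftrightarrow> (\<forall>t. h integrable_on {0..t} \<and> bounded (h ` {0..t}))"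

lemma cesaro_regular_cesaro_mean:
  assumes "cesaro_regular h"
  shows "cesaro_regular (cesaro_mean h)"
  unfolding cesaro_regular_def
proof
  fix t :: real
  from assms obtain B where B: "\<And>x. x \<in> {0..t} \<Longrightarrow> norm (h x) \<le> B"
    unfolding cesaro_regular_def bounded_iff by (metis imageI)
  have int: "h integrable_on {0..u}" for u using assms by (auto simp: cesaro_regular_def)
  have bd: "norm (cesaro_mean h u) \<le> \<bar>B\<bar>" if u: "u \<in> {0..t}" for u
  proof (cases "u = 0")
    case False
    have "norm (integral {0..u} h) \<le> integral {0..u} (\<lambda>_. \<bar>B\<bar>)"
    proof (rule integral_norm_bound_integral)
      show "norm (h x) \<le> \<bar>B\<bar>" if "x \<in> {0..u}" for x
        using B[of x] that u by auto
    qed (auto intro: int)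
    also have "\<dots> = \<bar>B\<bar> * u" using u by simp
    finally show ?thesis using u False
      by (simp add: cesaro_mean_def norm_mult norm_divide field_simps)
  qed (simp add: cesaro_mean_def)
  have "continuous_on {0<..t} (cesaro_mean h)"
    unfolding cesaro_mean_def
    by (intro continuous_intros continuous_on_subset[OF indefinite_integral_continuous_1[OF int[of t]]]) auto
  then have meas: "cesaro_mean h \<in> borel_measurable (lebesgue_on {0<..t})"
    by (rule continuous_imp_measurable_on_sets_lebesgue) simp
  have "(\<lambda>_. \<bar>B\<bar>) integrable_on {0<..t}"
    by (rule integrable_spike_set[of _ "{0..t}"]) (auto intro: negligible_subset[of "{0}"])
  with meas have "cesaro_mean h integrable_on {0<..t}"
    by (rule measurable_bounded_by_integrable_imp_integrable) (use bd in auto)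
  then have "cesaro_mean h integrable_on {0..t}"
    by (rule integrable_spike_set) (auto intro: negligible_subset[of "{0}"])
  moreover have "bounded (cesaro_mean h ` {0..t})" unfolding bounded_iff using bd by blast
  ultimately show "cesaro_mean h integrable_on {0..t} \<and> bounded (cesaro_mean h ` {0..t})" ..
qed

lemma cesaro_regular_funpow: "cesaro_regular h \<Longrightarrow> cesaro_regular ((cesaro_mean ^^ k) h)"
  by (induction k) (auto intro: cesaro_regular_cesaro_mean)

section \<open>Power-log sums have no nonzero generalised limit\<close>

text \<open>Division by \<open>t\<close> does not raise the order \<open>N\<close>. For the induction, integrate
  by parts against the primitive of \<open>f\<close>: with \<open>g\<close> the mean of \<open>f\<close>, the mean of \<open>f / t\<close> is
  \<open>g / t\<close> plus the mean of \<open>g / t\<close>.\<close>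

lemma mean_limit_over_t:
  assumes "mean_limit N f L" "continuous_on {1..} f"
  shows "mean_limit N (\<lambda>t. f t / of_real t) 0"
  using assms
proof (induction N arbitrary: f)
  case 0
  have "((\<lambda>t. f t * (1 / of_real t)) \<longlongrightarrow> L * 0) at_top"
    using 0 by (intro tendsto_mult const_over_t_tendsto_0) auto
  moreover have "continuous_on {1..} (\<lambda>t. f t / of_real t)"
    using 0 by (intro continuous_intros) auto
  ultimately show ?case by (simp add: tail_integrable_continuous)
next
  case (Suc N)
  define g where "g = tail_mean f"
  have f: "tail_integrable f" and g: "mean_limit N g L" using Suc.prems by (auto simp: g_def)
  have gcont: "continuous_on {1..} g" unfolding g_def by (rule continuous_on_tail_mean[OF f])
  have IH: "mean_limit N (\<lambda>t. g t / of_real t) 0" by (rule Suc.IH[OF g gcont])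
  have cf: "continuous_on {1..} (\<lambda>t. f t / of_real t)"
    using Suc.prems by (intro continuous_intros) auto
  have eq: "tail_mean (\<lambda>t. f t / of_real t) t = g t / of_real t + tail_mean (\<lambda>t. g t / of_real t) t"
    if t: "t \<ge> 1" for t
  proof -
    have "((\<lambda>u. f u / of_real u - g u / of_real u) has_integral
            (integral {1..t} f / of_real t - integral {1..1} f / of_real 1)) {1..t}"
    proof (rule fundamental_theorem_of_calculus)
      fix u assume u: "u \<in> {1..t}"
      have "((\<lambda>u. integral {1..u} f) has_vector_derivative f u) (at u within {1..t})"
        using Suc.prems u by (intro integral_has_vector_derivative) (auto elim: continuous_on_subset)
      note F = this
      have "((\<lambda>u. integral {1..u} f * inverse (of_real u)) has_vector_derivative
          (integral {1..u} f * (- inverse (of_real u ^ 2)) + f u * inverse (of_real u))) (at u within {1..t})"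
      proof -
        have "(inverse has_field_derivative - inverse (complex_of_real u ^ 2)) (at (of_real u))"
          using u DERIV_inverse[of "complex_of_real u"] by (simp add: numeral_2_eq_2)
        then have "(inverse has_field_derivative - inverse (complex_of_real u ^ 2))
            (at (of_real u) within of_real ` {1..t})"
          by (rule has_field_derivative_at_within)
        from field_vector_diff_chain_within[where f = of_real and f' = 1, OF _ this]
        have "((\<lambda>u. inverse (complex_of_real u)) has_vector_derivative - inverse (of_real u ^ 2))
            (at u within {1..t})"
          unfolding o_def mult_1 by (rule meta_mp) (auto intro!: derivative_eq_intros)
        then show ?thesis
          using has_vector_derivative_mult[OF F]
          by blast
      qed
      then show "((\<lambda>u. integral {1..u} f / of_real u) has_vector_derivative
          (f u / of_real u - g u / of_real u)) (at u within {1..t})"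
        by (simp add: g_def tail_mean_def field_simps power2_eq_square)
    qed (use t in auto)
    then have "integral {1..t} (\<lambda>u. f u / of_real u - g u / of_real u) = g t"
      by (auto simp: g_def tail_mean_def dest!: integral_unique)
    moreover have "integral {1..t} (\<lambda>u. f u / of_real u - g u / of_real u) =
        integral {1..t} (\<lambda>u. f u / of_real u) - integral {1..t} (\<lambda>u. g u / of_real u)"
      using tail_integrable_continuous[OF cf] mean_limit_imp_tail_integrable[OF IH]
      by (intro integral_diff) (auto simp: tail_integrable_def)
    ultimately show ?thesis using t by (simp add: tail_mean_def field_simps)
  qed
  have "mean_limit N (\<lambda>t. g t / of_real t + tail_mean (\<lambda>t. g t / of_real t) t) (0 + 0)"
    using mean_limit_Suc[OF IH] by (intro mean_limit_add IH) auto
  then have "mean_limit N (tail_mean (\<lambda>t. f t / of_real t)) 0"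
    using mean_limit_cong[OF eq] by simp
  then show ?case using tail_integrable_continuous[OF cf] by simp
qed

text \<open>Integration by parts writes the mean of \<open>(z + t) f'\<close> as \<open>f\<close> minus the mean of \<open>f\<close>,
  up to terms of size \<open>f / t\<close> and \<open>1 / t\<close>,
  and the two main terms have the same limit.\<close>

lemma mean_limit_euler_derivative:
  assumes lim: "mean_limit N f L"
    and deriv: "\<And>t. t \<ge> 1 \<Longrightarrow> (f has_vector_derivative f' t) (at t)"
    and cont: "continuous_on {1..} f'"
  shows "mean_limit (Suc N) (\<lambda>t. (z + of_real t) * f' t) 0"
proof -
  have cf: "continuous_on {1..} f"
    using deriv by (intro continuous_at_imp_continuous_on ballI has_vector_derivative_continuous) auto
  have int: "tail_integrable f" by (rule tail_integrable_continuous[OF cf])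
  have cont': "continuous_on {1..} (\<lambda>t. (z + of_real t) * f' t)"
    by (intro continuous_intros cont)
  have eq: "tail_mean (\<lambda>t. (z + of_real t) * f' t) t =
     f t + z * (f t / of_real t) - (z + 1) * f 1 / of_real t - tail_mean f t" if t: "t \<ge> 1" for t
  proof -
    have "((\<lambda>u. (z + of_real u) * f' u + f u) has_integral
            ((z + of_real t) * f t - (z + of_real 1) * f 1)) {1..t}"
    proof (rule fundamental_theorem_of_calculus)
      fix u assume u: "u \<in> {1..t}"
      show "((\<lambda>u. (z + of_real u) * f u) has_vector_derivative ((z + of_real u) * f' u + f u))
          (at u within {1..t})"
      proof -
        have "((\<lambda>u. z + of_real u) has_vector_derivative 1) (at u within {1..t})"
          by (auto intro!: derivative_eq_intros)
        moreover have "(f has_vector_derivative f' u) (at u within {1..t})"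
          using deriv[of u] u by (auto intro: has_vector_derivative_at_within)
        ultimately show ?thesis
          using has_vector_derivative_mult[of "\<lambda>u. z + of_real u" 1 u "{1..t}" f "f' u"] by simp
      qed
    qed (use t in auto)
    then have "integral {1..t} (\<lambda>u. (z + of_real u) * f' u + f u) =
        (z + of_real t) * f t - (z + of_real 1) * f 1"
      by (rule integral_unique)
    moreover have "integral {1..t} (\<lambda>u. (z + of_real u) * f' u + f u) =
       integral {1..t} (\<lambda>u. (z + of_real u) * f' u) + integral {1..t} f"
      using tail_integrable_continuous[OF cont'] int
      by (intro integral_add) (auto simp: tail_integrable_def)
    ultimately have "integral {1..t} (\<lambda>u. (z + of_real u) * f' u) =
       (z + of_real t) * f t - (z + 1) * f 1 - integral {1..t} f"
      by (simp add: algebra_simps)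
    then have "tail_mean (\<lambda>t. (z + of_real t) * f' t) t =
        ((z + of_real t) * f t - (z + 1) * f 1 - integral {1..t} f) / of_real t"
      by (simp only: tail_mean_def) simp
    then show ?thesis
      by (rule trans) (use t in \<open>simp add: tail_mean_def field_simps\<close>)
  qed
  have "mean_limit N (tail_mean f) L" using mean_limit_Suc[OF lim] by simp
  then have "mean_limit N (\<lambda>t. f t + z * (f t / of_real t) - (z + 1) * f 1 / of_real t - tail_mean f t)
     (L + z * 0 - 0 - L)"
    by (intro mean_limit_add mean_limit_diff mean_limit_cmult mean_limit_const_over
        mean_limit_over_t[OF lim cf] lim)
  then have "mean_limit N (tail_mean (\<lambda>t. (z + of_real t) * f' t)) 0"
    using mean_limit_cong[OF eq] by simp
  then show ?thesis using tail_integrable_continuous[OF cont'] by simp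
qed

text \<open>The terms of \<open>(\<theta> - r) S\<close> for the power-log sum \<open>S\<close> given by \<open>ts\<close>, where \<open>\<theta> = w d/dw\<close>.
  Terms whose coefficient is \<open>0\<close> are omitted, so that enough applications leave the empty
  list.\<close>

definition lower_terms ::
  "complex \<Rightarrow> (complex \<times> complex \<times> nat) list \<Rightarrow> (complex \<times> complex \<times> nat) list" where
  "lower_terms r ts = concat (map (\<lambda>(a, \<rho>, m).
      (if \<rho> = r then [] else [(a * (\<rho> - r), \<rho>, m)]) @
      (if m = 0 then [] else [(a * of_nat m, \<rho>, m - 1)])) ts)"

lemma power_log_sum_Nil [simp]: "power_log_sum [] w = 0"
  by (simp add: power_log_sum_def)

lemma power_log_sum_Cons [simp]:
  "power_log_sum ((a, \<rho>, m) # ts) w = a * w powr \<rho> * Ln w ^ m + power_log_sum ts w"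
  by (simp add: power_log_sum_def)

lemma power_log_sum_append [simp]:
  "power_log_sum (ts @ us) w = power_log_sum ts w + power_log_sum us w"
  by (simp add: power_log_sum_def)

lemma power_log_sum_uminus:
  "power_log_sum (map (\<lambda>(a, \<rho>, m). (- a, \<rho>, m)) ts) w = - power_log_sum ts w"
  by (induction ts) auto

lemma power_log_sum_has_field_derivative:
  assumes "w \<notin> \<real>\<^sub>\<le>\<^sub>0"
  shows "(power_log_sum ts has_field_derivative
           (power_log_sum (lower_terms r ts) w + r * power_log_sum ts w) / w) (at w)"
proof (induction ts)
  case Nil
  have "power_log_sum [] = (\<lambda>_. 0)" by (intro ext) simp
  then show ?case by (simp add: lower_terms_def)
next
  case (Cons t ts)
  obtain a \<rho> m where t: "t = (a, \<rho>, m)" by (metis prod_cases3)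
  have w: "w \<noteq> 0" using assms by auto
  have "((\<lambda>w. a * w powr \<rho> * Ln w ^ m) has_field_derivative
     (a * (\<rho> * w powr (\<rho> - 1)) * Ln w ^ m + a * w powr \<rho> * (of_nat m * Ln w ^ (m - 1) / w))) (at w)"
    using assms w by (auto intro!: derivative_eq_intros has_field_derivative_powr simp: field_simps)
  from DERIV_add[OF this Cons.IH]
  have "(power_log_sum (t # ts) has_field_derivative
     (a * (\<rho> * w powr (\<rho> - 1)) * Ln w ^ m + a * w powr \<rho> * (of_nat m * Ln w ^ (m - 1) / w)
      + (power_log_sum (lower_terms r ts) w + r * power_log_sum ts w) / w)) (at w)"
    unfolding t by (rule DERIV_cong_ev[THEN iffD1, rotated -1]) auto
  also have "a * (\<rho> * w powr (\<rho> - 1)) * Ln w ^ m + a * w powr \<rho> * (of_nat m * Ln w ^ (m - 1) / w)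
      + (power_log_sum (lower_terms r ts) w + r * power_log_sum ts w) / w =
      (power_log_sum (lower_terms r (t # ts)) w + r * power_log_sum (t # ts) w) / w"
    using w by (simp add: t lower_terms_def powr_diff field_simps)
  finally show ?case .
qed

lemma lower_terms_count:
  assumes "\<forall>(a, \<rho>, m) \<in> set ts. m < count_list (r # rs) \<rho>"
  shows "\<forall>(a, \<rho>, m) \<in> set (lower_terms r ts). m < count_list rs \<rho>"
  using assms by (induction ts) (auto simp: lower_terms_def split: if_splits)

lemma continuous_on_power_log_sum:
  assumes "Re z > -1"
  shows "continuous_on {1..} (\<lambda>t. power_log_sum ts (z + of_real t))"
proof (intro continuous_at_imp_continuous_on ballI)
  fix t :: real assume "t \<in> {1..}"
  then have "z + of_real t \<notin> \<real>\<^sub>\<le>\<^sub>0" using assms by (auto simp: complex_nonpos_Reals_iff)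
  then have "isCont (power_log_sum ts) (z + of_real t)"
    using power_log_sum_has_field_derivative DERIV_isCont by blast
  then show "isCont (\<lambda>t. power_log_sum ts (z + of_real t)) t"
    by (intro isCont_o2[of _ "\<lambda>t. z + of_real t" "power_log_sum ts"] continuous_intros)
qed

text \<open>Let \<open>S\<close> have generalised limit \<open>L\<close>. Then \<open>(\<theta> - r) S\<close> has generalised limit \<open>- r L\<close>. Applying this
  for all \<open>r\<close> in \<open>rs\<close>, each exponent listed more often than the power of its logarithm, kills
  \<open>S\<close> and multiplies \<open>L\<close> by a product of nonzero numbers. This replaces a discussion of the
  oscillation of \<open>w powr \<rho>\<close> with imaginary \<open>\<rho>\<close>, and of constants hidden in expansions
  such as \<open>z + t\<close>.\<close>

lemma mean_limit_power_log_sum_aux: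
  assumes "Re z > -1" "0 \<notin> set rs"
    and "\<forall>(a, \<rho>, m) \<in> set ts. m < count_list rs \<rho>"
    and "mean_limit N (\<lambda>t. power_log_sum ts (z + of_real t)) L"
  shows "L = 0"
  using assms
proof (induction rs arbitrary: ts N L)
  case Nil
  then have "ts = []" by (cases ts) auto
  then have "mean_limit N (\<lambda>_. 0) L" using Nil by simp
  moreover have "mean_limit N (\<lambda>_. 0) L' \<Longrightarrow> L' = 0" for L'
  proof (induction N)
    case 0 then show ?case by (simp add: tendsto_const_iff)
  next
    case (Suc N)
    have "tail_mean (\<lambda>_. 0) = (\<lambda>_. 0)" by (intro ext) (simp add: tail_mean_def)
    with Suc show ?case by simp
  qed
  ultimately show ?case by blast
next
  case (Cons r rs)
  let ?f = "\<lambda>t::real. power_log_sum ts (z + of_real t)"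
  let ?g = "\<lambda>t::real. power_log_sum (lower_terms r ts) (z + of_real t)"
  have nz: "z + of_real t \<notin> \<real>\<^sub>\<le>\<^sub>0" if "t \<ge> 1" for t
    using Cons.prems that by (auto simp: complex_nonpos_Reals_iff)
  have nz0: "z + of_real t \<noteq> 0" if "t \<ge> 1" for t using nz[OF that] by auto
  have deriv: "(?f has_vector_derivative (?g t + r * ?f t) / (z + of_real t)) (at t)" if "t \<ge> 1" for t
  proof -
    have "((\<lambda>t. z + of_real t) has_vector_derivative 1) (at t)"
      by (auto intro!: derivative_eq_intros)
    from field_vector_diff_chain_at[OF this power_log_sum_has_field_derivative[OF nz[OF that]]]
    show ?thesis by (simp add: o_def)
  qed
  have "mean_limit (Suc N) (\<lambda>t. (z + of_real t) * ((?g t + r * ?f t) / (z + of_real t))) 0"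
    using Cons.prems(1) nz0
    by (intro mean_limit_euler_derivative[OF Cons.prems(4) deriv] continuous_intros
          continuous_on_power_log_sum) auto
  then have "mean_limit (Suc N) (\<lambda>t. ?g t + r * ?f t) 0"
    by (subst mean_limit_cong[of _ "\<lambda>t. (z + of_real t) * ((?g t + r * ?f t) / (z + of_real t))"])
       (use nz0 in auto)
  from mean_limit_diff[OF this mean_limit_cmult[OF mean_limit_Suc[OF Cons.prems(4)], of r]]
  have "mean_limit (Suc N) ?g (- r * L)" by (simp del: mean_limit.simps)
  then have "- r * L = 0"
    using Cons.prems(1,2) lower_terms_count[OF Cons.prems(3)] by (intro Cons.IH[of _ "Suc N"]) auto
  then show ?case using Cons.prems by simp
qed

lemma mean_limit_power_log_sum:
  assumes "Re z > -1" "power_log_terms ts" "mean_limit N (\<lambda>t. power_log_sum ts (z + of_real t)) L"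
  shows "L = 0"
proof -
  have "\<exists>rs. 0 \<notin> set rs \<and> (\<forall>(a, \<rho>, m) \<in> set ts. m < count_list rs \<rho>)"
    using assms(2)
  proof (induction ts)
    case (Cons t ts)
    then obtain rs where rs: "0 \<notin> set rs" "\<forall>(a, \<rho>, m) \<in> set ts. m < count_list rs \<rho>"
      by (auto simp: power_log_terms_def)
    obtain a \<rho> m where t: "t = (a, \<rho>, m)" by (metis prod_cases3)
    have c: "count_list (replicate (Suc m) \<rho>) \<rho> = Suc m" by (induction m) auto
    have "0 \<notin> set (replicate (Suc m) \<rho> @ rs)" using Cons.prems rs by (auto simp: t power_log_terms_def)
    moreover have "\<forall>(a', \<rho>', m') \<in> set (t # ts). m' < count_list (replicate (Suc m) \<rho> @ rs) \<rho>'"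
      using rs(2) c by (force simp: t count_list_append simp del: replicate.simps)
    ultimately show ?case by blast
  qed (auto intro: exI[of _ "[]"])
  then show ?thesis using mean_limit_power_log_sum_aux assms by blast
qed

section \<open>Uniqueness of remainder Cesaro sums\<close>

lemma hurwitz_partial_sum_eq:
  assumes "t \<le> b"
  shows "hurwitz_partial_sum z s t =
     (\<Sum>n = 1..nat \<lfloor>b\<rfloor>. if t \<in> {real n..} then (z + of_nat n) powr (- s) else 0)"
proof -
  have "{1..nat \<lfloor>t\<rfloor>} = {n \<in> {1..nat \<lfloor>b\<rfloor>}. real n \<le> t}"
  proof (intro set_eqI iffI)
    fix n assume n: "n \<in> {1..nat \<lfloor>t\<rfloor>}"
    then have "int n \<le> \<lfloor>t\<rfloor>" by auto
    then have "real n \<le> t" by (simp add: le_floor_iff)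
    moreover have "int n \<le> \<lfloor>b\<rfloor>" using \<open>int n \<le> \<lfloor>t\<rfloor>\<close> floor_mono[OF assms] by linarith
    ultimately show "n \<in> {n \<in> {1..nat \<lfloor>b\<rfloor>}. real n \<le> t}" using n by auto
  next
    fix n assume n: "n \<in> {n \<in> {1..nat \<lfloor>b\<rfloor>}. real n \<le> t}"
    then have "int n \<le> \<lfloor>t\<rfloor>" by (simp add: le_floor_iff)
    then show "n \<in> {1..nat \<lfloor>t\<rfloor>}" using n by auto
  qed
  then show ?thesis
    unfolding hurwitz_partial_sum_def by (simp add: sum.inter_filter del: atLeastAtMost_iff)
qed

lemma hurwitz_partial_sum_integrable: "hurwitz_partial_sum z s integrable_on {a..b}"
proof -
  have "(\<lambda>t. \<Sum>n = 1..nat \<lfloor>b\<rfloor>. if t \<in> {real n..} then (z + of_nat n) powr (- s) else 0) integrable_on {a..b}"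
  proof (intro integrable_sum)
    fix n
    have "{real n..} \<inter> {a..b} = {max (real n) a..b}" by auto
    then show "(\<lambda>t. if t \<in> {real n..} then (z + of_nat n) powr (- s) else 0) integrable_on {a..b}"
      by (subst integrable_restrict_Int) auto
  qed auto
  then show ?thesis
    by (rule integrable_eq) (auto simp: hurwitz_partial_sum_eq)
qed

lemma has_remainder_cesaro_sum_imp_mean_limit:
  assumes "Re z > -1" "has_remainder_cesaro_sum z s L"
  obtains ts N where "power_log_terms ts"
    "mean_limit N (\<lambda>t. hurwitz_partial_sum z s t - power_log_sum ts (z + of_real t)) L"
proof -
  from assms(2) obtain ts N where ts: "power_log_terms ts"
    and int: "\<And>k t. k < N \<Longrightarrow> t > 0 \<Longrightarrow> (cesaro_mean ^^ k)
       (\<lambda>t. hurwitz_partial_sum z s t - power_log_sum ts (z + of_real t)) integrable_on {0..t}"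
    and lim: "(((cesaro_mean ^^ N)
       (\<lambda>t. hurwitz_partial_sum z s t - power_log_sum ts (z + of_real t))) \<longlongrightarrow> L) at_top"
    unfolding has_remainder_cesaro_sum_def has_cesaro_limit_def by blast
  have "tail_integrable (\<lambda>t. hurwitz_partial_sum z s t - power_log_sum ts (z + of_real t))"
    using tail_integrable_continuous[OF continuous_on_power_log_sum[OF assms(1)]]
    by (auto simp: tail_integrable_def intro!: integrable_diff hurwitz_partial_sum_integrable)
  then have "mean_limit N (\<lambda>t. hurwitz_partial_sum z s t - power_log_sum ts (z + of_real t)) L"
    using lim cesaro_mean_tail_mean_iff[OF int, where g = "\<lambda>_. 0"]
      tail_integrable_continuous[of "\<lambda>_. 0"] by auto
  with ts that show thesis by blast
qed

text \<open>The difference of two remainders of one partial-sum function is a power-log sum, to which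
  the previous result applies; hence the definite description in \<^const>\<open>hurwitz_zeta\<close>
  denotes any value that is found.\<close>

lemma has_remainder_cesaro_sum_unique:
  assumes z: "Re z > -1" and "has_remainder_cesaro_sum z s L" "has_remainder_cesaro_sum z s M"
  shows "L = M"
proof -
  let ?F = "hurwitz_partial_sum z s"
  obtain ts N where ts: "power_log_terms ts" "mean_limit N (\<lambda>t. ?F t - power_log_sum ts (z + of_real t)) L"
    using has_remainder_cesaro_sum_imp_mean_limit[OF assms(1,2)] .
  obtain us K where us: "power_log_terms us" "mean_limit K (\<lambda>t. ?F t - power_log_sum us (z + of_real t)) M"
    using has_remainder_cesaro_sum_imp_mean_limit[OF assms(1,3)] .
  define vs where "vs = us @ map (\<lambda>(a, \<rho>, m). (- a, \<rho>, m)) ts"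
  have "mean_limit (max N K)
     (\<lambda>t. (?F t - power_log_sum ts (z + of_real t)) - (?F t - power_log_sum us (z + of_real t))) (L - M)"
    by (intro mean_limit_diff mean_limit_mono[OF ts(2)] mean_limit_mono[OF us(2)]) auto
  then have "mean_limit (max N K) (\<lambda>t. power_log_sum vs (z + of_real t)) (L - M)"
    unfolding vs_def power_log_sum_append power_log_sum_uminus by (simp add: algebra_simps)
  moreover have "power_log_terms vs"
    using ts us by (auto simp: vs_def power_log_terms_def)
  ultimately show ?thesis using mean_limit_power_log_sum[OF z] by fastforce
qed

section \<open>Periodic polynomials times complex powers\<close>

text \<open>The 1-periodic extension of a polynomial on \<open>[0,1)\<close>, as for Bernoulli polynomials.\<close>

definition periodic_poly :: "real poly \<Rightarrow> real \<Rightarrow> complex" where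
  "periodic_poly g u = of_real (poly g (frac u))"

text \<open>The step from one Bernoulli polynomial to the next. Mean zero makes the primitive agree at
  \<open>0\<close> and \<open>1\<close>, so that its periodic extension is continuous, and the free constant makes it mean
  zero again.\<close>

lemma mean_zero_primitive:
  fixes g :: "real poly"
  assumes "integral {0..1} (poly g) = 0"
  obtains G where "pderiv G = g" "poly G 1 = poly G 0" "integral {0..1} (poly G) = 0"
proof -
  define H :: "real poly" where "H = (\<Sum>i\<le>degree g. monom (coeff g i / real (Suc i)) (Suc i))"
  have H: "pderiv H = g"
    unfolding H_def
    by (subst poly_as_sum_of_monoms[symmetric, of g])
       (simp add: higher_pderiv_sum[of 1, simplified] pderiv_monom del: of_nat_Suc)
  define G where "G = H - [:integral {0..1} (poly H):]"
  have G: "pderiv G = g" by (simp add: G_def pderiv_diff H pderiv_pCons)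
  have "(poly g has_integral (poly G 1 - poly G 0)) {0..1}"
    using G by (intro fundamental_theorem_of_calculus)
      (auto intro!: has_field_derivative_at_within[OF poly_DERIV]
        simp: has_real_derivative_iff_has_vector_derivative[symmetric])
  then have "poly G 1 = poly G 0" using assms by (auto dest: integral_unique)
  moreover have "integral {0..1} (poly G) = 0"
  proof -
    have "poly G = (\<lambda>x. poly H x - integral {0..1} (poly H))" by (auto simp: G_def)
    moreover have "(poly H has_integral integral {0..1} (poly H)) {0..1}"
      by (intro integrable_integral integrable_continuous_real continuous_intros)
    from has_integral_diff[OF this has_integral_const_real[of "integral {0..1} (poly H)" 0 1]]
    have "((\<lambda>x. poly H x - integral {0..1} (poly H)) has_integral 0) {0..1}" by simp
    ultimately show ?thesis by (simp add: integral_unique)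
  qed
  ultimately show thesis using that G by blast
qed

lemma periodic_poly_bounded: "\<exists>B. \<forall>u. norm (periodic_poly g u) \<le> B"
proof -
  have "compact (poly g ` {0..1})" by (intro compact_continuous_image continuous_intros) auto
  then obtain B where B: "\<And>x. x \<in> {0..1} \<Longrightarrow> norm (poly g x) \<le> B"
    using compact_imp_bounded bounded_iff by (metis imageI)
  have "norm (periodic_poly g u) \<le> B" for u
    using B[of "frac u"] frac_lt_1[of u] by (simp add: periodic_poly_def)
  then show ?thesis by blast
qed

lemma periodic_poly_of_nat [simp]: "periodic_poly g (real n) = of_real (poly g 0)"
  by (simp add: periodic_poly_def frac_def)

lemma periodic_poly_1 [simp]: "periodic_poly g 1 = of_real (poly g 0)"
  using periodic_poly_of_nat[of g 1] by simp

lemma periodic_poly_times_integrable: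
  assumes "continuous_on {a..b} f"
  shows "(\<lambda>u. periodic_poly g u * f u) integrable_on {a..b}"
proof -
  obtain B where B: "\<And>u. norm (periodic_poly g u) \<le> B" using periodic_poly_bounded[of g] by blast
  have "continuous_on UNIV (poly g)" by (intro continuous_intros)
  then have pm: "poly g \<in> borel_measurable borel" by (rule borel_measurable_continuous_onI)
  have "frac \<in> borel_measurable (borel :: real measure)" unfolding frac_def by measurable
  from measurable_compose[OF this pm]
  have "(\<lambda>u. of_real (poly g (frac u)) :: complex) \<in> borel_measurable borel" by measurable
  then have "periodic_poly g \<in> borel_measurable lborel"
    by (simp add: periodic_poly_def[abs_def])
  then have "periodic_poly g \<in> borel_measurable (lebesgue_on {a..b})"
    by (intro measurable_restrict_space1 measurable_completion)
  moreover have "f \<in> borel_measurable (lebesgue_on {a..b})"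
    using assms by (rule continuous_imp_measurable_on_sets_lebesgue) simp
  ultimately have meas: "(\<lambda>u. periodic_poly g u * f u) \<in> borel_measurable (lebesgue_on {a..b})"
    by (rule borel_measurable_times)
  have "(\<lambda>u. B * norm (f u)) integrable_on {a..b}"
    using assms by (intro integrable_continuous_real continuous_intros)
  with meas show ?thesis
    by (rule measurable_bounded_by_integrable_imp_integrable)
       (auto simp: norm_mult intro!: mult_right_mono B)
qed

lemma periodic_poly_eq: "of_int k \<le> u \<Longrightarrow> u < of_int k + 1 \<Longrightarrow> periodic_poly g u = of_real (poly g (u - of_int k))"
proof -
  assume "of_int k \<le> u" "u < of_int k + 1"
  then have "\<lfloor>u\<rfloor> = k" by linarith
  then show ?thesis by (simp add: periodic_poly_def frac_def)
qed

lemma continuous_on_periodic_poly: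
  assumes "poly G 1 = poly G 0"
  shows "continuous_on S (periodic_poly G)"
proof (intro continuous_at_imp_continuous_on ballI)
  fix x :: real
  define k where "k = \<lfloor>x\<rfloor>"
  have k: "of_int k \<le> x" "x < of_int k + 1" unfolding k_def by linarith+
  have right: "(periodic_poly G \<longlongrightarrow> periodic_poly G x) (at_right x)"
  proof (rule Lim_transform_eventually)
    show "((\<lambda>u. of_real (poly G (u - of_int k))) \<longlongrightarrow> periodic_poly G x) (at_right x)"
      unfolding periodic_poly_eq[OF k] by (intro tendsto_intros)
    show "eventually (\<lambda>u. of_real (poly G (u - of_int k)) = periodic_poly G u) (at_right x)"
      unfolding eventually_at_right_field
      by (rule exI[of _ "of_int k + 1"]) (use k in \<open>auto simp: periodic_poly_eq[of k]\<close>)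
  qed
  have left: "(periodic_poly G \<longlongrightarrow> periodic_poly G x) (at_left x)"
  proof (cases "x = of_int k")
    case False
    show ?thesis
    proof (rule Lim_transform_eventually)
      show "((\<lambda>u. of_real (poly G (u - of_int k))) \<longlongrightarrow> periodic_poly G x) (at_left x)"
        unfolding periodic_poly_eq[OF k] by (intro tendsto_intros)
      show "eventually (\<lambda>u. of_real (poly G (u - of_int k)) = periodic_poly G u) (at_left x)"
        unfolding eventually_at_left_field
        by (rule exI[of _ "of_int k"]) (use k False in \<open>auto simp: periodic_poly_eq[of k]\<close>)
    qed
  next
    case True
    show ?thesis
    proof (rule Lim_transform_eventually)
      have "((\<lambda>u. complex_of_real (poly G (u - of_int (k - 1)))) \<longlongrightarrow> of_real (poly G (x - of_int (k - 1)))) (at_left x)"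
        by (intro tendsto_intros)
      then show "((\<lambda>u. of_real (poly G (u - of_int (k - 1)))) \<longlongrightarrow> periodic_poly G x) (at_left x)"
        using True assms by (simp add: periodic_poly_def)
      show "eventually (\<lambda>u. of_real (poly G (u - of_int (k - 1))) = periodic_poly G u) (at_left x)"
        unfolding eventually_at_left_field
        by (rule exI[of _ "of_int (k - 1)"])
          (use True in \<open>auto simp: periodic_poly_eq[of "k - 1"]\<close>)
    qed
  qed
  show "isCont (periodic_poly G) x"
    unfolding isCont_def filterlim_at_split using left right by blast
qed

text \<open>Only \<open>G\<close> has to be periodic without jumps; \<open>g\<close> may jump at the integers, which are finitely
  many in \<open>[1,t]\<close>.\<close>

lemma periodic_poly_by_parts:
  assumes G: "pderiv G = g" "poly G 1 = poly G 0" and t: "t \<ge> 1"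
    and f: "\<And>u. u \<ge> 1 \<Longrightarrow> (f has_vector_derivative f' u) (at u)" "continuous_on {1..} f'"
  shows "integral {1..t} (\<lambda>u. periodic_poly g u * f u) =
     periodic_poly G t * f t - of_real (poly G 0) * f 1 - integral {1..t} (\<lambda>u. periodic_poly G u * f' u)"
proof -
  have cf: "continuous_on {1..} f"
    using f by (intro continuous_at_imp_continuous_on ballI has_vector_derivative_continuous) auto
  have "((\<lambda>u. periodic_poly g u * f u + periodic_poly G u * f' u) has_integral
          (periodic_poly G t * f t - periodic_poly G 1 * f 1)) {1..t}"
  proof (rule fundamental_theorem_of_calculus_interior_strong)
    show "finite (real ` {..nat \<lceil>t\<rceil>})" by simp
    show "continuous_on {1..t} (\<lambda>u. periodic_poly G u * f u)"
      using continuous_on_subset[OF cf, of "{1..t}"]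
      by (intro continuous_intros continuous_on_periodic_poly G) auto
    fix u assume u: "u \<in> {1<..<t} - real ` {..nat \<lceil>t\<rceil>}"
    define k where "k = \<lfloor>u\<rfloor>"
    have k: "of_int k \<le> u" "u < of_int k + 1" unfolding k_def by linarith+
    have "u \<noteq> of_int k"
    proof
      assume *: "u = of_int k"
      then have "u = real (nat k)" using u by simp
      moreover have "nat k \<le> nat \<lceil>t\<rceil>" using u * by (intro nat_mono less_imp_le) (simp add: less_ceiling_iff)
      ultimately show False using u by blast
    qed
    then have uk: "u \<in> {of_int k<..<of_int k + 1}" using k by auto
    have "((\<lambda>u. poly G (u - of_int k)) has_real_derivative poly g (u - of_int k)) (at u)"
      using G by (auto intro!: derivative_eq_intros DERIV_chain'[of "\<lambda>u. u - of_int k"])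
    then have "((\<lambda>u. complex_of_real (poly G (u - of_int k))) has_vector_derivative of_real (poly g (u - of_int k))) (at u)"
      by (rule has_vector_derivative_of_real)
    then have "(periodic_poly G has_vector_derivative of_real (poly g (u - of_int k))) (at u)"
      by (rule has_vector_derivative_transform_within_open[OF _ _ uk])
         (auto simp: periodic_poly_eq[of k])
    then have "(periodic_poly G has_vector_derivative periodic_poly g u) (at u)"
      using k by (simp add: periodic_poly_eq)
    from has_vector_derivative_mult[OF this f(1)[of u]]
    show "((\<lambda>u. periodic_poly G u * f u) has_vector_derivative
        periodic_poly g u * f u + periodic_poly G u * f' u) (at u)"
      using u by (simp add: add.commute)
  qed (use t in auto)
  then have "integral {1..t} (\<lambda>u. periodic_poly g u * f u + periodic_poly G u * f' u) =
     periodic_poly G t * f t - of_real (poly G 0) * f 1"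
    using periodic_poly_1 by (auto dest: integral_unique)
  moreover have "integral {1..t} (\<lambda>u. periodic_poly g u * f u + periodic_poly G u * f' u) =
     integral {1..t} (\<lambda>u. periodic_poly g u * f u) + integral {1..t} (\<lambda>u. periodic_poly G u * f' u)"
    by (intro integral_add periodic_poly_times_integrable continuous_on_subset[OF cf]
          continuous_on_subset[OF f(2)]) auto
  ultimately show ?thesis by (simp add: algebra_simps)
qed

lemma shift_powr_has_vector_derivative:
  assumes "Re z + t > 0"
  shows "((\<lambda>t. (z + of_real t) powr a) has_vector_derivative a * (z + of_real t) powr (a - 1)) (at t)"
proof -
  have nz: "z + of_real t \<notin> \<real>\<^sub>\<le>\<^sub>0" using assms by (auto simp: complex_nonpos_Reals_iff)
  have "((\<lambda>t. z + of_real t) has_vector_derivative 1) (at t)"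
    by (auto intro!: derivative_eq_intros)
  from field_vector_diff_chain_at[OF this has_field_derivative_powr[OF nz, of a]]
  show ?thesis by (simp add: o_def)
qed

lemma continuous_on_shift_powr:
  assumes "\<And>t. t \<in> S \<Longrightarrow> Re z + t > 0"
  shows "continuous_on S (\<lambda>t. (z + of_real t) powr a)"
  using assms
  by (intro continuous_at_imp_continuous_on ballI
        has_vector_derivative_continuous[OF shift_powr_has_vector_derivative]) auto

lemma norm_powr_le:
  assumes "Re w \<ge> x" "x > 0" "Re a \<le> 0"
  shows "norm (w powr a) \<le> exp (pi * \<bar>Im a\<bar>) * x powr Re a"
proof -
  have "norm (w powr a) = norm w powr Re a * exp (- Im a * Arg w)"
    by (rule norm_powr_complex)
  also have "\<dots> \<le> x powr Re a * exp (pi * \<bar>Im a\<bar>)"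
  proof (intro mult_mono)
    have "x \<le> norm w" using complex_Re_le_cmod[of w] assms by linarith
    then show "norm w powr Re a \<le> x powr Re a"
      using assms by (intro powr_mono2') auto
    have "- Im a * Arg w \<le> \<bar>Im a\<bar> * \<bar>Arg w\<bar>" by (metis abs_ge_self abs_minus_cancel abs_mult)
    also have "\<dots> \<le> \<bar>Im a\<bar> * pi" using Arg_bounded[of w] by (intro mult_left_mono) auto
    finally show "exp (- Im a * Arg w) \<le> exp (pi * \<bar>Im a\<bar>)" by (simp add: mult.commute)
  qed auto
  finally show ?thesis by (simp add: mult.commute)
qed

lemma real_powr_neg_tendsto_0: "r < 0 \<Longrightarrow> ((\<lambda>t::real. (x + t) powr r) \<longlongrightarrow> 0) at_top"
  by (rule tendsto_neg_powr) (auto intro: filterlim_tendsto_add_at_top filterlim_ident)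

text \<open>One mean trades a unit of growth: integrating by parts moves to a primitive of \<open>g\<close>, which is
  again periodic with mean zero, and lowers the exponent \<open>a\<close> by one. After \<open>N > Re a\<close> means the
  function decays.\<close>

lemma periodic_poly_powr_mean_limit:
  assumes "integral {0..1} (poly g) = 0" "Re z > -1" "Re a < real N"
  shows "mean_limit N (\<lambda>t. periodic_poly g t * (z + of_real t) powr a) 0"
  using assms(1,3)
proof (induction N arbitrary: g a)
  case 0
  obtain B where B: "\<And>u. norm (periodic_poly g u) \<le> B" using periodic_poly_bounded[of g] by blast
  have "((\<lambda>t. periodic_poly g t * (z + of_real t) powr a) \<longlongrightarrow> 0) at_top"
  proof (rule Lim_null_comparison)
    have "((\<lambda>t. B * (exp (pi * \<bar>Im a\<bar>) * (Re z + t) powr Re a)) \<longlongrightarrow> B * (exp (pi * \<bar>Im a\<bar>) * 0)) at_top"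
      using 0 by (intro tendsto_intros real_powr_neg_tendsto_0) auto
    then show "((\<lambda>t. B * (exp (pi * \<bar>Im a\<bar>) * (Re z + t) powr Re a)) \<longlongrightarrow> 0) at_top" by simp
    show "eventually (\<lambda>t. norm (periodic_poly g t * (z + of_real t) powr a)
       \<le> B * (exp (pi * \<bar>Im a\<bar>) * (Re z + t) powr Re a)) at_top"
      using eventually_ge_at_top[of "1::real"]
    proof eventually_elim
      case (elim t)
      show ?case
        unfolding norm_mult
        using elim assms 0 B[of t] order_trans[OF norm_ge_zero B[of t]] by (intro mult_mono norm_powr_le) auto
    qed
  qed
  moreover have "tail_integrable (\<lambda>t. periodic_poly g t * (z + of_real t) powr a)"
    unfolding tail_integrable_def using assms(2)
    by (intro allI periodic_poly_times_integrable continuous_on_shift_powr) auto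
  ultimately show ?case by simp
next
  case (Suc N)
  obtain G where G: "pderiv G = g" "poly G 1 = poly G 0" "integral {0..1} (poly G) = 0"
    using mean_zero_primitive[OF Suc.prems(1)] .
  let ?h = "\<lambda>t. periodic_poly G t * (z + of_real t) powr (a - 1)"
  define c where "c = of_real (poly G 0) * (z + of_real 1) powr a"
  have ti: "tail_integrable (\<lambda>t. periodic_poly g t * (z + of_real t) powr a)"
    unfolding tail_integrable_def using assms(2)
    by (intro allI periodic_poly_times_integrable continuous_on_shift_powr) auto
  have IH: "mean_limit N ?h 0" using Suc.prems by (intro Suc.IH G) auto
  have ch: "continuous_on {1..} ?h"
    using assms(2) by (intro continuous_intros continuous_on_periodic_poly G continuous_on_shift_powr) auto
  have eq: "tail_mean (\<lambda>t. periodic_poly g t * (z + of_real t) powr a) t =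
     ?h t + z * (?h t / of_real t) - c / of_real t - a * tail_mean ?h t" if t: "t \<ge> 1" for t
  proof -
    have "integral {1..t} (\<lambda>u. periodic_poly g u * (z + of_real u) powr a) =
       periodic_poly G t * (z + of_real t) powr a - c
       - integral {1..t} (\<lambda>u. periodic_poly G u * (a * (z + of_real u) powr (a - 1)))"
      unfolding c_def using assms(2)
      by (intro periodic_poly_by_parts[OF G(1,2) t] shift_powr_has_vector_derivative
            continuous_intros continuous_on_shift_powr) auto
    also have "(\<lambda>u. periodic_poly G u * (a * (z + of_real u) powr (a - 1))) = (\<lambda>u. a * ?h u)"
      by (simp add: mult.left_commute)
    also have "integral {1..t} \<dots> = a * integral {1..t} ?h" by simp
    also have "(z + of_real t) powr a = (z + of_real t) * (z + of_real t) powr (a - 1)"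
    proof -
      have "z + of_real t \<noteq> 0" using assms(2) t by (auto simp: complex_eq_iff)
      then show ?thesis by (simp add: powr_diff)
    qed
    finally have "tail_mean (\<lambda>t. periodic_poly g t * (z + of_real t) powr a) t =
      (periodic_poly G t * ((z + of_real t) * (z + of_real t) powr (a - 1)) - c - a * integral {1..t} ?h) / of_real t"
      by (simp only: tail_mean_def) simp
    then show ?thesis
      by (rule trans) (use t in \<open>simp add: tail_mean_def field_simps\<close>)
  qed
  have "mean_limit N (tail_mean ?h) 0" using mean_limit_Suc[OF IH] by simp
  then have "mean_limit N (\<lambda>t. ?h t + z * (?h t / of_real t) - c / of_real t - a * tail_mean ?h t)
     (0 + z * 0 - 0 - a * 0)"
    by (intro mean_limit_add mean_limit_diff mean_limit_cmult mean_limit_const_over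
        mean_limit_over_t[OF IH ch] IH)
  then have "mean_limit N (tail_mean (\<lambda>t. periodic_poly g t * (z + of_real t) powr a)) 0"
    using mean_limit_cong[OF eq] by simp
  then show ?case using ti by simp
qed

section \<open>Regularised integrals of periodic polynomials times powers\<close>

definition unit_powr_integral :: "real poly \<Rightarrow> complex \<Rightarrow> complex \<Rightarrow> complex" where
  "unit_powr_integral g a w = integral {0..1} (\<lambda>v. of_real (poly g v) * (w + of_real v) powr a)"

definition periodic_powr_integral :: "real poly \<Rightarrow> complex \<Rightarrow> complex \<Rightarrow> real \<Rightarrow> complex" where
  "periodic_powr_integral g a z t =
     integral {1..t} (\<lambda>u. periodic_poly g u * (z + of_real u) powr a)"

lemma unit_powr_integral_deriv:
  assumes "Re w > 0"
  shows "(unit_powr_integral g a has_field_derivative a * unit_powr_integral g (a - 1) w) (at w)"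
proof -
  define U where "U = {w. Re w > 0}"
  have U: "open U" "convex U" "w \<in> U"
    using assms by (auto simp: U_def open_halfspace_Re_gt convex_halfspace_Re_gt)
  have "((\<lambda>w. integral (cbox 0 1) (\<lambda>v. of_real (poly g v) * (w + of_real v) powr a)) has_field_derivative
      integral (cbox 0 1) (\<lambda>v. of_real (poly g v) * (a * (w + of_real v) powr (a - 1)))) (at w within U)"
  proof (rule leibniz_rule_field_derivative)
    show "((\<lambda>w. complex_of_real (poly g v) * (w + of_real v) powr a) has_field_derivative
       complex_of_real (poly g v) * (a * (x + of_real v) powr (a - 1))) (at x within U)"
      if "x \<in> U" "v \<in> cbox 0 1" for x v
    proof -
      have "x + of_real v \<notin> \<real>\<^sub>\<le>\<^sub>0" using that by (auto simp: U_def complex_nonpos_Reals_iff)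
      from has_field_derivative_powr[OF this, of a]
      have "((\<lambda>w. (w + of_real v) powr a) has_field_derivative a * (x + of_real v) powr (a - 1)) (at x)"
        by (subst (asm) DERIV_shift)
      then show ?thesis by (rule DERIV_cmult[OF has_field_derivative_at_within])
    qed
    show "(\<lambda>v. complex_of_real (poly g v) * (x + of_real v) powr a) integrable_on cbox 0 1" if "x \<in> U" for x
      using that unfolding cbox_interval
      by (intro integrable_continuous_real continuous_intros continuous_on_shift_powr) (auto simp: U_def)
    show "continuous_on (U \<times> cbox 0 1)
       (\<lambda>(x, v). complex_of_real (poly g v) * (a * (x + of_real v) powr (a - 1)))"
      unfolding case_prod_unfold
      by (intro continuous_intros) (auto simp: U_def complex_eq_iff)
  qed (use U in auto)
  moreover have "(\<lambda>v. of_real (poly g v) * (a * (w + of_real v) powr (a - 1))) =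
      (\<lambda>v. a * (of_real (poly g v) * (w + of_real v) powr (a - 1)))"
    by (intro ext) (rule mult.left_commute)
  ultimately have "((\<lambda>w. integral (cbox 0 1) (\<lambda>v. of_real (poly g v) * (w + of_real v) powr a))
      has_field_derivative integral (cbox 0 1) (\<lambda>v. a * (of_real (poly g v) * (w + of_real v) powr (a - 1))))
      (at w within U)" by simp
  then show ?thesis
    using at_within_open[OF U(3,1)] unfolding unit_powr_integral_def[abs_def] by simp
qed

lemma unit_powr_integral_bound:
  assumes "Re a \<le> 0"
  obtains C where "\<And>w x. x > 0 \<Longrightarrow> Re w \<ge> x \<Longrightarrow> norm (unit_powr_integral g a w) \<le> C * x powr Re a"
proof -
  obtain B where B: "\<And>u. norm (periodic_poly g u) \<le> B" using periodic_poly_bounded[of g] by blast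
  define B' where "B' = max B (norm (poly g 1))"
  have B': "norm (poly g v) \<le> B'" if "v \<in> {0..1}" for v
  proof (cases "v = 1")
    case False
    then have "periodic_poly g v = of_real (poly g v)" using that periodic_poly_eq[of 0 v g] by auto
    then show ?thesis using B[of v] by (auto simp: B'_def)
  qed (auto simp: B'_def)
  show thesis
  proof (rule that[of "B' * exp (pi * \<bar>Im a\<bar>)"])
    fix w :: complex and x :: real
    assume x: "x > 0" "Re w \<ge> x"
    have "norm (integral {0..1} (\<lambda>v. of_real (poly g v) * (w + of_real v) powr a))
        \<le> B' * (exp (pi * \<bar>Im a\<bar>) * x powr Re a) * (1 - 0)"
    proof (rule integral_bound)
      show "continuous_on {0..1} (\<lambda>v. complex_of_real (poly g v) * (w + of_real v) powr a)"
        using x by (intro continuous_intros continuous_on_shift_powr) auto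
      fix v :: real assume v: "v \<in> {0..1}"
      show "norm (of_real (poly g v) * (w + of_real v) powr a) \<le> B' * (exp (pi * \<bar>Im a\<bar>) * x powr Re a)"
        unfolding norm_mult norm_of_real
        using x v assms B'[OF v] order_trans[OF norm_ge_zero B'[OF v]]
        by (intro mult_mono norm_powr_le) auto
    qed simp
    then show "norm (unit_powr_integral g a w) \<le> B' * exp (pi * \<bar>Im a\<bar>) * x powr Re a"
      by (simp add: unit_powr_integral_def mult.assoc)
  qed
qed

lemma unit_powr_integral_by_parts:
  assumes G: "pderiv G = g" "poly G 1 = poly G 0" and w: "Re w > 0"
  shows "unit_powr_integral g a w =
     of_real (poly G 0) * ((w + 1) powr a - w powr a) - a * unit_powr_integral G (a - 1) w"
proof -
  have "((\<lambda>v. of_real (poly g v) * (w + of_real v) powr a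
          + a * (of_real (poly G v) * (w + of_real v) powr (a - 1))) has_integral
        (of_real (poly G 1) * (w + of_real 1) powr a - of_real (poly G 0) * (w + of_real 0) powr a)) {0..1}"
  proof (rule fundamental_theorem_of_calculus)
    fix v :: real assume v: "v \<in> {0..1}"
    have "((\<lambda>v. of_real (poly G v)) has_vector_derivative of_real (poly g v)) (at v)"
      using G(1) poly_DERIV[of G v] by (auto intro!: has_vector_derivative_of_real)
    from has_vector_derivative_mult[OF this shift_powr_has_vector_derivative[of w v a]]
    have "((\<lambda>v. of_real (poly G v) * (w + of_real v) powr a) has_vector_derivative
        of_real (poly g v) * (w + of_real v) powr a
          + a * (of_real (poly G v) * (w + of_real v) powr (a - 1))) (at v)"
      using w v by (simp add: algebra_simps)
    then show "((\<lambda>v. of_real (poly G v) * (w + of_real v) powr a) has_vector_derivative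
        of_real (poly g v) * (w + of_real v) powr a
          + a * (of_real (poly G v) * (w + of_real v) powr (a - 1))) (at v within {0..1})"
      by (rule has_vector_derivative_at_within)
  qed simp
  then have "integral {0..1} (\<lambda>v. of_real (poly g v) * (w + of_real v) powr a
          + a * (of_real (poly G v) * (w + of_real v) powr (a - 1))) =
      of_real (poly G 0) * ((w + 1) powr a - w powr a)"
    using G(2) by (auto dest!: integral_unique simp: algebra_simps)
  moreover have "integral {0..1} (\<lambda>v. of_real (poly g v) * (w + of_real v) powr a
          + a * (of_real (poly G v) * (w + of_real v) powr (a - 1))) =
      unit_powr_integral g a w + integral {0..1} (\<lambda>v. a * (of_real (poly G v) * (w + of_real v) powr (a - 1)))"
    unfolding unit_powr_integral_def using w
    by (intro integral_add integrable_continuous_real continuous_intros continuous_on_shift_powr) auto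
  ultimately show ?thesis by (simp add: unit_powr_integral_def algebra_simps)
qed

lemma integral_unit_interval:
  assumes "Re z > -1" "n \<ge> 1"
  shows "integral {real n..real (Suc n)} (\<lambda>u. periodic_poly g u * (z + of_real u) powr a) =
     unit_powr_integral g a (z + of_nat n)"
proof -
  define f where "f = (\<lambda>u. complex_of_real (poly g (u - real n)) * (z + of_real u) powr a)"
  have cf: "continuous_on {0 + real n..1 + real n} f"
    unfolding f_def using assms by (intro continuous_intros continuous_on_shift_powr) auto
  have "integral {real n..real (Suc n)} (\<lambda>u. periodic_poly g u * (z + of_real u) powr a) =
      integral {real n..real (Suc n)} f"
  proof (rule integral_spike[of "{real (Suc n)}"])
    fix u assume "u \<in> {real n..real (Suc n)} - {real (Suc n)}"
    then show "f u = periodic_poly g u * (z + of_real u) powr a"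
      using periodic_poly_eq[of "int n" u g] by (simp add: f_def)
  qed simp
  also have "\<dots> = integral {0..1} (f \<circ> (\<lambda>x. x + real n))"
    using integral_shift[OF cf] by (simp add: add.commute)
  also have "f \<circ> (\<lambda>x. x + real n) = (\<lambda>v. of_real (poly g v) * (z + of_nat n + of_real v) powr a)"
    by (auto simp: f_def fun_eq_iff add_ac)
  finally show ?thesis by (simp add: unit_powr_integral_def)
qed

lemma periodic_powr_integral_nat:
  assumes "Re z > -1"
  shows "periodic_powr_integral g a z (real (Suc n)) = (\<Sum>k<n. unit_powr_integral g a (z + of_nat (Suc k)))"
proof (induction n)
  case 0 then show ?case by (simp add: periodic_powr_integral_def)
next
  case (Suc n)
  let ?f = "\<lambda>u. periodic_poly g u * (z + of_real u) powr a"
  have "?f integrable_on {1..real (Suc (Suc n))}"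
    using assms by (intro periodic_poly_times_integrable continuous_on_shift_powr) auto
  then have "integral {1..real (Suc (Suc n))} ?f =
      integral {1..real (Suc n)} ?f + integral {real (Suc n)..real (Suc (Suc n))} ?f"
    by (intro Henstock_Kurzweil_Integration.integral_combine[symmetric]) auto
  then show ?case
    using Suc integral_unit_interval[OF assms, of "Suc n" g a]
    by (simp add: periodic_powr_integral_def del: of_nat_Suc)
qed

lemma tail_integrable_periodic_powr_integral:
  assumes "Re z > -1"
  shows "tail_integrable (periodic_powr_integral g a z)"
proof -
  have "tail_integrable (\<lambda>u. periodic_poly g u * (z + of_real u) powr a)"
    unfolding tail_integrable_def using assms
    by (intro allI periodic_poly_times_integrable continuous_on_shift_powr) auto
  from tail_integrable_continuous[OF continuous_on_tail_primitive[OF this]]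
  show ?thesis unfolding periodic_powr_integral_def[abs_def] .
qed

text \<open>The series controls the integral at integer endpoints; the leftover piece of a unit interval
  is as small as the integrand.\<close>

lemma periodic_powr_integral_tendsto:
  assumes "Re z > -1" "Re a < 0"
    and sums: "(\<lambda>k. unit_powr_integral g a (z + of_nat (Suc k))) sums L"
  shows "(periodic_powr_integral g a z \<longlongrightarrow> L) at_top"
proof -
  let ?f = "\<lambda>u. periodic_poly g u * (z + of_real u) powr a"
  let ?I = "periodic_powr_integral g a z"
  obtain B where B: "\<And>u. norm (periodic_poly g u) \<le> B" using periodic_poly_bounded[of g] by blast
  define C where "C = B * exp (pi * \<bar>Im a\<bar>)"
  have F: "filterlim (\<lambda>t::real. nat \<lfloor>t\<rfloor>) sequentially at_top"
    by (rule filterlim_compose[OF filterlim_nat_sequentially filterlim_floor_sequentially])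
  have S: "(\<lambda>n. ?I (real n)) \<longlonglongrightarrow> L"
    using sums by (subst filterlim_sequentially_Suc[symmetric])
      (simp add: periodic_powr_integral_nat[OF assms(1)] sums_def del: of_nat_Suc)
  have A: "((\<lambda>t::real. ?I (real (nat \<lfloor>t\<rfloor>))) \<longlongrightarrow> L) at_top"
    by (rule filterlim_compose[OF S F])
  have "((\<lambda>t. ?I t - ?I (real (nat \<lfloor>t\<rfloor>))) \<longlongrightarrow> 0) at_top"
  proof (rule Lim_null_comparison)
    have "((\<lambda>t. C * (Re z - 1 + t) powr Re a) \<longlongrightarrow> C * 0) at_top"
      using assms by (intro tendsto_intros real_powr_neg_tendsto_0)
    then show "((\<lambda>t. C * (Re z - 1 + t) powr Re a) \<longlongrightarrow> 0) at_top" by simp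
    show "eventually (\<lambda>t. norm (?I t - ?I (real (nat \<lfloor>t\<rfloor>))) \<le> C * (Re z - 1 + t) powr Re a) at_top"
      using eventually_ge_at_top[of "3::real"]
    proof eventually_elim
      case (elim t)
      define k where "k = real (nat \<lfloor>t\<rfloor>)"
      have k: "k \<le> t" "t < k + 1" "1 \<le> k" using elim unfolding k_def by linarith+
      have int: "?f integrable_on {1..t}"
        using assms by (intro periodic_poly_times_integrable continuous_on_shift_powr) auto
      have "?I t - ?I k = integral {k..t} ?f"
        unfolding periodic_powr_integral_def
        using Henstock_Kurzweil_Integration.integral_combine[OF k(3) k(1) int] by (simp add: algebra_simps)
      also have "norm \<dots> \<le> integral {k..t} (\<lambda>_. C * (Re z - 1 + t) powr Re a)"
      proof (rule integral_norm_bound_integral)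
        show "?f integrable_on {k..t}" using k by (intro integrable_subinterval_real[OF int]) auto
        fix u assume u: "u \<in> {k..t}"
        have "norm (?f u) \<le> B * (exp (pi * \<bar>Im a\<bar>) * (Re z - 1 + t) powr Re a)"
          unfolding norm_mult using u k elim assms B[of u] order_trans[OF norm_ge_zero B[of u]]
          by (intro mult_mono norm_powr_le) auto
        then show "norm (?f u) \<le> C * (Re z - 1 + t) powr Re a" by (simp add: C_def mult_ac)
      qed auto
      also have "\<dots> = (t - k) * (C * (Re z - 1 + t) powr Re a)" using k by simp
      also have "\<dots> \<le> 1 * (C * (Re z - 1 + t) powr Re a)"
        using k order_trans[OF norm_ge_zero B[of 0]] by (intro mult_right_mono) (auto simp: C_def)
      finally show ?case by (simp add: k_def)
    qed
  qed
  from tendsto_add[OF this A] show ?thesis by simp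
qed

text \<open>Regard \<open>K\<close> and \<open>K'\<close> as the regularised integrals of \<open>p(u) (z + u)\<^sup>a\<close> and
  \<open>p(u) (z + u)\<^bsup>a-1\<^esup>\<close> over \<open>[1,\<infinity>)\<close>, with \<open>p\<close> the periodic extension of \<open>g\<close>. Both
  are carried along together because the derivative of \<open>K\<close> involves \<open>K'\<close>, and the shift relation
  because the value near \<open>z = -1\<close> is reached from \<open>z = 0\<close> by it.\<close>

definition powr_limit_pair ::
  "real poly \<Rightarrow> complex \<Rightarrow> (complex \<Rightarrow> complex) \<Rightarrow> (complex \<Rightarrow> complex) \<Rightarrow> bool" where
  "powr_limit_pair g a K K' \<longleftrightarrow>
     (\<forall>z N. Re z > -1 \<longrightarrow> Re a + 1 < real N \<longrightarrow> mean_limit N (periodic_powr_integral g a z) (K z)) \<and>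
     (\<forall>z N. Re z > -1 \<longrightarrow> Re a < real N \<longrightarrow> mean_limit N (periodic_powr_integral g (a - 1) z) (K' z)) \<and>
     (\<forall>z. Re z > -1 \<longrightarrow> (K has_field_derivative a * K' z) (at z)) \<and>
     (\<forall>x. Re x > 0 \<longrightarrow> K (x - 1) = unit_powr_integral g a x + K x)"

lemma unit_powr_integral_summable_uniform:
  assumes "Re a < -1"
  shows "uniformly_convergent_on {z. Re z > -1} (\<lambda>n z. \<Sum>k<n. unit_powr_integral g a (z + of_nat (Suc k)))"
proof -
  obtain C where C: "\<And>w x. x > 0 \<Longrightarrow> Re w \<ge> x \<Longrightarrow> norm (unit_powr_integral g a w) \<le> C * x powr Re a"
    using unit_powr_integral_bound[of a g] assms by (metis less_imp_le less_trans neg_less_0_iff_less zero_less_one)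
  show ?thesis
  proof (rule Weierstrass_m_test'_ev)
    show "eventually (\<lambda>k. \<forall>z\<in>{z. Re z > -1}. norm (unit_powr_integral g a (z + of_nat (Suc k))) \<le>
        C * real k powr Re a) sequentially"
      using eventually_gt_at_top[of 0] by eventually_elim (auto intro!: C)
    show "summable (\<lambda>k. C * real k powr Re a)"
      using assms by (intro summable_mult) (simp add: summable_real_powr_iff)
  qed
qed

lemma unit_powr_integral_summable:
  assumes "Re a < -1" "Re z > -1"
  shows "summable (\<lambda>k. unit_powr_integral g a (z + of_nat (Suc k)))"
proof -
  have "convergent (\<lambda>n. \<Sum>k<n. unit_powr_integral g a (z + of_nat (Suc k)))"
    by (rule uniformly_convergent_imp_convergent[OF unit_powr_integral_summable_uniform[OF assms(1), of g]])
       (use assms in auto)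
  then show ?thesis by (simp add: summable_iff_convergent)
qed

text \<open>For \<open>Re a < -1\<close> the integral converges absolutely; cutting it into unit intervals gives a
  series of holomorphic functions that may be differentiated termwise, and the shift relation is
  the splitting of its first term.\<close>

lemma powr_limit_pair_base:
  assumes a: "Re a < -1"
  shows "\<exists>K K'. powr_limit_pair g a K K'"
proof -
  define K where "K = (\<lambda>b z. \<Sum>k. unit_powr_integral g b (z + of_nat (Suc k)))"
  define S :: "complex set" where "S = {z. Re z > -1}"
  have S: "open S" "convex S" by (auto simp: S_def open_halfspace_Re_gt convex_halfspace_Re_gt)
  have lim: "mean_limit N (periodic_powr_integral g b z) (K b z)" if "Re b < -1" "Re z > -1" for b z N
    unfolding K_def using that
    by (intro mean_limit_of_tendsto tail_integrable_periodic_powr_integral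
        periodic_powr_integral_tendsto summable_sums unit_powr_integral_summable) auto
  have a': "Re (a - 1) < -1" using a by simp
  have deriv: "(K a has_field_derivative a * K (a - 1) z) (at z)" if z: "z \<in> S" for z
  proof -
    have "(K a has_field_derivative (\<Sum>k. a * unit_powr_integral g (a - 1) (z + of_nat (Suc k)))) (at z)"
      unfolding K_def
    proof (rule has_field_derivative_series'(2)[OF S(2)])
      fix k x assume "x \<in> S"
      then have "Re (x + of_nat (Suc k)) > 0" by (auto simp: S_def)
      from unit_powr_integral_deriv[OF this, of g a]
      have "((\<lambda>z. unit_powr_integral g a (z + of_nat (Suc k))) has_field_derivative
         a * unit_powr_integral g (a - 1) (x + of_nat (Suc k))) (at x)"
        by (subst (asm) DERIV_shift)
      then show "((\<lambda>z. unit_powr_integral g a (z + of_nat (Suc k))) has_field_derivative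
         a * unit_powr_integral g (a - 1) (x + of_nat (Suc k))) (at x within S)"
        by (rule has_field_derivative_at_within)
    next
      have "uniformly_convergent_on S (\<lambda>n z. a * (\<Sum>k<n. unit_powr_integral g (a - 1) (z + of_nat (Suc k))))"
        using unit_powr_integral_summable_uniform[OF a', of g] unfolding S_def
        by (intro uniformly_convergent_mult)
      then show "uniformly_convergent_on S (\<lambda>n z. \<Sum>k<n. a * unit_powr_integral g (a - 1) (z + of_nat (Suc k)))"
        by (simp add: sum_distrib_left)
    next
      show "summable (\<lambda>k. unit_powr_integral g a (0 + of_nat (Suc k)))"
        using a by (intro unit_powr_integral_summable) auto
    qed (use z S in \<open>auto simp: S_def interior_open\<close>)
    also have "(\<Sum>k. a * unit_powr_integral g (a - 1) (z + of_nat (Suc k))) = a * K (a - 1) z"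
      unfolding K_def using z by (intro suminf_mult unit_powr_integral_summable a') (auto simp: S_def)
    finally show ?thesis .
  qed
  have shift: "K a (x - 1) = unit_powr_integral g a x + K a x" if x: "Re x > 0" for x
  proof -
    have "summable (\<lambda>k. unit_powr_integral g a (x - 1 + of_nat (Suc k)))"
      using x a by (intro unit_powr_integral_summable) auto
    from suminf_split_head[OF this] show ?thesis unfolding K_def by (simp add: algebra_simps)
  qed
  have "powr_limit_pair g a (K a) (K (a - 1))"
    unfolding powr_limit_pair_def using lim[OF a] lim[OF a'] deriv shift by (auto simp: S_def)
  then show ?thesis by blast
qed

text \<open>Integration by parts expresses the pair for \<open>(g, a)\<close> through the pair for a mean-zero
  primitive of \<open>g\<close> and \<open>a - 1\<close>. This reaches every exponent, and the three relations are inherited.\<close>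

lemma powr_limit_pair_exists:
  assumes "integral {0..1} (poly g) = 0" "Re a + 1 < real M"
  shows "\<exists>K K'. powr_limit_pair g a K K'"
  using assms
proof (induction M arbitrary: g a)
  case 0
  then show ?case by (intro powr_limit_pair_base) auto
next
  case (Suc M)
  obtain G where G: "pderiv G = g" "poly G 1 = poly G 0" "integral {0..1} (poly G) = 0"
    using mean_zero_primitive[OF Suc.prems(1)] .
  define c :: complex where "c = of_real (poly G 0)"
  from Suc.IH[OF G(3), of "a - 1"] Suc.prems
  obtain K K' where K: "powr_limit_pair G (a - 1) K K'" by auto
  \<comment> \<open>The boundary terms of the integration by parts at \<open>1\<close>; those at \<open>t\<close> have limit \<open>0\<close>.\<close>
  define H where "H = (\<lambda>z. - c * (z + 1) powr a - a * K z)"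
  define H' where "H' = (\<lambda>z. - c * (z + 1) powr (a - 1) - (a - 1) * K' z)"
  have parts: "periodic_powr_integral g b z t = periodic_poly G t * (z + of_real t) powr b
      + - c * (z + 1) powr b - b * periodic_powr_integral G (b - 1) z t"
    if "Re z > -1" "t \<ge> 1" for b z t
  proof -
    have "periodic_powr_integral g b z t = periodic_poly G t * (z + of_real t) powr b
       - c * (z + of_real 1) powr b
       - integral {1..t} (\<lambda>u. periodic_poly G u * (b * (z + of_real u) powr (b - 1)))"
      unfolding c_def periodic_powr_integral_def using that(1)
      by (intro periodic_poly_by_parts[OF G(1,2) that(2)] shift_powr_has_vector_derivative
            continuous_intros continuous_on_shift_powr) auto
    also have "(\<lambda>u. periodic_poly G u * (b * (z + of_real u) powr (b - 1))) =
        (\<lambda>u. b * (periodic_poly G u * (z + of_real u) powr (b - 1)))"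
      by (intro ext) (rule mult.left_commute)
    finally show ?thesis by (simp add: periodic_powr_integral_def)
  qed
  have lim: "mean_limit N (periodic_powr_integral g b z) (- c * (z + 1) powr b - b * L)"
    if z: "Re z > -1" and "Re b < real N" and L: "mean_limit N (periodic_powr_integral G (b - 1) z) L" for b z N L
  proof -
    have "mean_limit N (\<lambda>t. periodic_poly G t * (z + of_real t) powr b
      + - c * (z + 1) powr b - b * periodic_powr_integral G (b - 1) z t)
      (0 + - c * (z + 1) powr b - b * L)"
      using that by (intro mean_limit_add mean_limit_diff mean_limit_const mean_limit_cmult
          periodic_poly_powr_mean_limit G)
    then show ?thesis
      by (subst mean_limit_cong[OF parts[OF z]]) simp_all
  qed
  have "powr_limit_pair g a H H'"
    unfolding powr_limit_pair_def
  proof (intro conjI allI impI)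
    fix z :: complex and N :: nat
    assume z: "Re z > -1"
    show "mean_limit N (periodic_powr_integral g a z) (H z)" if "Re a + 1 < real N"
      unfolding H_def using that z K by (intro lim) (auto simp: powr_limit_pair_def)
    show "mean_limit N (periodic_powr_integral g (a - 1) z) (H' z)" if "Re a < real N"
      unfolding H'_def using that z K by (intro lim) (auto simp: powr_limit_pair_def)
    have "z + 1 \<notin> \<real>\<^sub>\<le>\<^sub>0" using z by (auto simp: complex_nonpos_Reals_iff)
    from has_field_derivative_powr[OF this, of a]
    have 1: "((\<lambda>z. (z + 1) powr a) has_field_derivative a * (z + 1) powr (a - 1)) (at z)"
      by (subst (asm) DERIV_shift)
    have 2: "(K has_field_derivative (a - 1) * K' z) (at z)"
      using K z by (auto simp: powr_limit_pair_def)
    show "(H has_field_derivative a * H' z) (at z)"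
      unfolding H_def H'_def
      using DERIV_diff[OF DERIV_cmult[OF 1, of "- c"] DERIV_cmult[OF 2, of a]] by (simp add: algebra_simps)
  next
    fix x :: complex assume x: "Re x > 0"
    have "K (x - 1) = unit_powr_integral G (a - 1) x + K x"
      using K x by (auto simp: powr_limit_pair_def)
    then show "H (x - 1) = unit_powr_integral g a x + H x"
      unfolding H_def unit_powr_integral_by_parts[OF G(1,2) x, of a]
      by (simp add: c_def algebra_simps)
  qed
  then show ?case by blast
qed

section \<open>The Euler--Maclaurin formula\<close>

text \<open>The first Bernoulli polynomial.\<close>

definition sawtooth :: "real poly" where "sawtooth = [:-1/2, 1:]"

lemma sawtooth_mean_zero: "integral {0..1} (poly sawtooth) = 0"
proof -
  have "((\<lambda>x::real. x - 1/2) has_integral (1\<^sup>2/2 - 1/2 * 1) - (0\<^sup>2/2 - 1/2 * 0)) {0..1}"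
    by (rule fundamental_theorem_of_calculus)
       (auto intro!: derivative_eq_intros simp: has_real_derivative_iff_has_vector_derivative[symmetric])
  moreover have "poly sawtooth = (\<lambda>x. x - 1/2)" by (auto simp: sawtooth_def)
  ultimately show ?thesis by (auto dest!: integral_unique)
qed

lemma periodic_poly_sawtooth: "periodic_poly sawtooth t = of_real t - 1/2 - of_int \<lfloor>t\<rfloor>"
  by (simp add: periodic_poly_def sawtooth_def frac_def)

lemma shift_powr_has_integral:
  assumes "Re z + a > 0" "a \<le> b"
  shows "((\<lambda>u. r * (z + of_real u) powr (r - 1)) has_integral
           ((z + of_real b) powr r - (z + of_real a) powr r)) {a..b}"
  using assms
  by (intro fundamental_theorem_of_calculus)
     (auto intro!: has_vector_derivative_at_within[OF shift_powr_has_vector_derivative])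

text \<open>Split the sawtooth as \<open>u - 1/2\<close> minus the integer part of \<open>u\<close>. Against the derivative of
  \<open>\<phi>(u) = (z + u)\<^bsup>-s\<^esup>\<close>, the first part is integrated by parts, and the integer part, as a sum of
  indicators of the half-lines \<open>[n,\<infinity>)\<close>, gives the partial sum by telescoping.\<close>

lemma hurwitz_partial_sum_euler_maclaurin:
  assumes z: "Re z > -1" and s: "s \<noteq> 1" and t: "t \<ge> 1"
  shows "hurwitz_partial_sum z s t - (z + of_real t) powr (1 - s) / (1 - s) =
     (z + 1) powr (- s) / 2 - (z + 1) powr (1 - s) / (1 - s)
     - periodic_poly sawtooth t * (z + of_real t) powr (- s)
     - s * periodic_powr_integral sawtooth (- s - 1) z t"
proof -
  define \<phi> where "\<phi> = (\<lambda>u::real. (z + of_real u) powr (- s))"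
  define \<phi>' where "\<phi>' = (\<lambda>u::real. - s * (z + of_real u) powr (- s - 1))"
  define k where "k = nat \<lfloor>t\<rfloor>"
  have k: "of_nat k = (of_int \<lfloor>t\<rfloor> :: complex)" "real k \<le> t" using t unfolding k_def by auto
  have 1: "((\<lambda>u. (of_real u - 1/2) * \<phi>' u + \<phi> u) has_integral
      ((of_real t - 1/2) * \<phi> t - (of_real 1 - 1/2) * \<phi> 1)) {1..t}"
  proof (rule fundamental_theorem_of_calculus)
    fix u assume u: "u \<in> {1..t}"
    have "((\<lambda>u. complex_of_real u - 1/2) has_vector_derivative 1) (at u)"
      by (auto intro!: derivative_eq_intros)
    from has_vector_derivative_mult[OF this shift_powr_has_vector_derivative[of z u "- s"]] u z
    have "((\<lambda>u. (of_real u - 1/2) * \<phi> u) has_vector_derivative ((of_real u - 1/2) * \<phi>' u + \<phi> u)) (at u)"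
      by (simp add: \<phi>_def \<phi>'_def)
    then show "((\<lambda>u. (of_real u - 1/2) * \<phi> u) has_vector_derivative ((of_real u - 1/2) * \<phi>' u + \<phi> u)) (at u within {1..t})"
      by (rule has_vector_derivative_at_within)
  qed (use t in auto)
  have "((\<lambda>u. (1 - s) * (z + of_real u) powr (1 - s - 1)) has_integral
      ((z + of_real t) powr (1 - s) - (z + of_real 1) powr (1 - s))) {1..t}"
    using z t by (intro shift_powr_has_integral) auto
  from has_integral_mult_right[OF this, of "1 / (1 - s)"]
  have 2: "(\<phi> has_integral (((z + of_real t) powr (1 - s) - (z + 1) powr (1 - s)) / (1 - s))) {1..t}"
    using s by (simp add: \<phi>_def[abs_def])
  have 3: "((\<lambda>u. \<Sum>n = 1..k. if u \<in> {real n..} then \<phi>' u else 0) has_integral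
      (\<Sum>n = 1..k. \<phi> t - \<phi> (real n))) {1..t}"
  proof (rule has_integral_sum)
    fix n assume n: "n \<in> {1..k}"
    then have "real n \<le> t" "real n \<ge> 1" using k by auto
    then have "(\<phi>' has_integral (\<phi> t - \<phi> (real n))) {real n..t}"
      unfolding \<phi>_def \<phi>'_def using z by (intro shift_powr_has_integral) auto
    moreover have "{real n..t} = {real n..} \<inter> {1..t}" using \<open>real n \<ge> 1\<close> by auto
    ultimately show "((\<lambda>u. if u \<in> {real n..} then \<phi>' u else 0) has_integral (\<phi> t - \<phi> (real n))) {1..t}"
      by (subst has_integral_restrict_Int) simp
  qed simp
  have eq: "(of_real u - 1/2) * \<phi>' u + \<phi> u - \<phi> u - (\<Sum>n = 1..k. if u \<in> {real n..} then \<phi>' u else 0) =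
     - s * (periodic_poly sawtooth u * (z + of_real u) powr (- s - 1))" if u: "u \<in> {1..t}" for u
  proof -
    have "{n \<in> {1..k}. u \<in> {real n..}} = {1..nat \<lfloor>u\<rfloor>}"
    proof (intro set_eqI iffI)
      fix n assume "n \<in> {n \<in> {1..k}. u \<in> {real n..}}"
      then show "n \<in> {1..nat \<lfloor>u\<rfloor>}" by (auto simp: le_nat_iff le_floor_iff)
    next
      fix n assume n: "n \<in> {1..nat \<lfloor>u\<rfloor>}"
      then have "int n \<le> \<lfloor>u\<rfloor>" by auto
      then have "real n \<le> u" by (simp add: le_floor_iff)
      moreover have "n \<le> k" using n u nat_mono[OF floor_mono[of u t]] by (auto simp: k_def)
      ultimately show "n \<in> {n \<in> {1..k}. u \<in> {real n..}}" using n by auto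
    qed
    then have "(\<Sum>n = 1..k. if u \<in> {real n..} then \<phi>' u else 0) = of_nat (nat \<lfloor>u\<rfloor>) * \<phi>' u"
      by (subst sum.inter_filter[symmetric]) auto
    also have "of_nat (nat \<lfloor>u\<rfloor>) = (of_int \<lfloor>u\<rfloor> :: complex)" using u by auto
    finally show ?thesis by (simp add: periodic_poly_sawtooth \<phi>'_def algebra_simps)
  qed
  have "((\<lambda>u. - s * (periodic_poly sawtooth u * (z + of_real u) powr (- s - 1))) has_integral
      ((of_real t - 1/2) * \<phi> t - (of_real 1 - 1/2) * \<phi> 1
       - ((z + of_real t) powr (1 - s) - (z + 1) powr (1 - s)) / (1 - s)
       - (\<Sum>n = 1..k. \<phi> t - \<phi> (real n)))) {1..t}"
    by (rule has_integral_eq[OF eq has_integral_diff[OF has_integral_diff[OF 1 2] 3]])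
  from integral_unique[OF this]
  have "- s * periodic_powr_integral sawtooth (- s - 1) z t =
      (of_real t - 1/2) * \<phi> t - (of_real 1 - 1/2) * \<phi> 1
       - ((z + of_real t) powr (1 - s) - (z + 1) powr (1 - s)) / (1 - s)
       - (\<Sum>n = 1..k. \<phi> t - \<phi> (real n))"
    by (simp add: periodic_powr_integral_def)
  also have "(\<Sum>n = 1..k. \<phi> t - \<phi> (real n)) = of_nat k * \<phi> t - hurwitz_partial_sum z s t"
    by (simp add: sum_subtractf hurwitz_partial_sum_def k_def \<phi>_def)
  finally have *: "- s * periodic_powr_integral sawtooth (- s - 1) z t =
      (of_real t - 1/2) * \<phi> t - (of_real 1 - 1/2) * \<phi> 1
       - ((z + of_real t) powr (1 - s) - (z + 1) powr (1 - s)) / (1 - s)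
       - (of_nat k * \<phi> t - hurwitz_partial_sum z s t)" .
  have **: "hurwitz_partial_sum z s t = - s * periodic_powr_integral sawtooth (- s - 1) z t
       - (of_real t - 1/2) * \<phi> t + \<phi> 1 / 2
       + ((z + of_real t) powr (1 - s) - (z + 1) powr (1 - s)) / (1 - s) + of_int \<lfloor>t\<rfloor> * \<phi> t"
    unfolding * k(1)[symmetric] by (simp add: algebra_simps)
  have "\<phi> 1 = (z + 1) powr (- s)" "\<phi> t = (z + of_real t) powr (- s)" by (simp_all add: \<phi>_def)
  then show ?thesis unfolding ** periodic_poly_sawtooth by (simp add: algebra_simps diff_divide_distrib)
qed

section \<open>The value of the Hurwitz zeta function\<close>

text \<open>The principal branch jumps across the negative axis, but along the real line each half is
  a constant times a power of the distance to \<open>0\<close>. This is needed because \<open>x + t\<close> starts at the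
  possibly negative value \<open>x\<close>.\<close>

lemma continuous_on_real_powr:
  assumes "Re \<rho> > 0"
  shows "continuous_on S (\<lambda>x. complex_of_real x powr \<rho>)"
proof -
  have right: "continuous_on {0..} (\<lambda>x. complex_of_real x powr \<rho>)"
    using assms by (intro continuous_intros) auto
  have "continuous_on {..0} (\<lambda>x. (- 1) powr \<rho> * complex_of_real (- x) powr \<rho>)"
    using assms by (intro continuous_intros) auto
  moreover have "(- 1) powr \<rho> * complex_of_real (- x) powr \<rho> = complex_of_real x powr \<rho>" if "x \<le> 0" for x
    using that powr_neg_real_complex[of "- x" \<rho>] by (cases "x = 0") auto
  ultimately have left: "continuous_on {..0} (\<lambda>x. complex_of_real x powr \<rho>)"
    by (metis (no_types, lifting) atMost_iff continuous_on_cong)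
  have "continuous_on ({..0} \<union> {0..}) (\<lambda>x. complex_of_real x powr \<rho>)"
    by (intro continuous_on_closed_Un left right) auto
  moreover have "{..0} \<union> {0..} = (UNIV :: real set)" by auto
  ultimately show ?thesis by (metis continuous_on_subset top_greatest)
qed

lemma cesaro_regular_hurwitz_remainder:
  assumes "Re s < 1"
  shows "cesaro_regular (\<lambda>t. hurwitz_partial_sum z s t - c * complex_of_real (x + t) powr (1 - s))"
  unfolding cesaro_regular_def
proof (intro allI conjI)
  fix b :: real
  have cont: "continuous_on {0..b} (\<lambda>t. c * complex_of_real (x + t) powr (1 - s))"
    using assms
    by (intro continuous_intros continuous_on_compose2[OF continuous_on_real_powr[of "1 - s" UNIV]]) auto
  show "(\<lambda>t. hurwitz_partial_sum z s t - c * complex_of_real (x + t) powr (1 - s)) integrable_on {0..b}"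
    by (intro integrable_diff hurwitz_partial_sum_integrable integrable_continuous_real cont)
  define B where "B = (\<Sum>n = 1..nat \<lfloor>b\<rfloor>. norm ((z + of_nat n) powr (- s)))"
  have "norm (hurwitz_partial_sum z s t) \<le> B" if "t \<le> b" for t
    unfolding hurwitz_partial_sum_eq[OF that] B_def
    by (intro sum_norm_le) auto
  then have "bounded (hurwitz_partial_sum z s ` {0..b})" unfolding bounded_iff by (auto intro!: exI[of _ B])
  moreover have "bounded ((\<lambda>t. c * complex_of_real (x + t) powr (1 - s)) ` {0..b})"
    by (intro compact_imp_bounded compact_continuous_image cont) simp
  ultimately show "bounded ((\<lambda>t. hurwitz_partial_sum z s t - c * complex_of_real (x + t) powr (1 - s)) ` {0..b})"
    by (rule bounded_minus_comp)
qed

text \<open>The constant term of the Euler--Maclaurin formula, that is, the analytically continued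
  Hurwitz zeta function.\<close>

definition hurwitz_value :: "(complex \<Rightarrow> complex) \<Rightarrow> complex \<Rightarrow> complex \<Rightarrow> complex" where
  "hurwitz_value K' s z = (z + 1) powr (- s) / 2 - (z + 1) powr (1 - s) / (1 - s) - s * K' z"

text \<open>For \<open>Re s > 0\<close> the remainder converges without any averaging, and then no integrability is
  at stake; this matters for \<open>Re s \<ge> 2\<close>, when the discarded power is not integrable where
  \<open>x + t = 0\<close>. Otherwise its exponent has positive real part and the remainder is locally bounded.\<close>

lemma hurwitz_zeta_eq:
  assumes x: "x > -1" and s: "s \<noteq> 1" and K: "powr_limit_pair sawtooth (- s) K K'"
  shows "hurwitz_zeta (of_real x) s = hurwitz_value K' s (of_real x)"
proof -
  define z where "z = complex_of_real x"
  have z: "Re z > -1" using x by (simp add: z_def)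
  define h where "h = (\<lambda>t. hurwitz_partial_sum z s t - 1 / (1 - s) * complex_of_real (x + t) powr (1 - s))"
  \<comment> \<open>The order must exceed \<open>Re (- s)\<close>; it is \<open>0\<close> when convergence is classical.\<close>
  define N where "N = (if Re s > 0 then 0 else Suc (nat \<lceil>- Re s\<rceil>))"
  have N: "Re (- s) < real N" unfolding N_def by (auto) linarith
  have "mean_limit N (\<lambda>t. (z + 1) powr (- s) / 2 - (z + 1) powr (1 - s) / (1 - s)
     - periodic_poly sawtooth t * (z + of_real t) powr (- s)
     - s * periodic_powr_integral sawtooth (- s - 1) z t) 
     ((z + 1) powr (- s) / 2 - (z + 1) powr (1 - s) / (1 - s) - 0 - s * K' z)"
    using K z N
    by (intro mean_limit_diff mean_limit_const mean_limit_cmult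
        periodic_poly_powr_mean_limit sawtooth_mean_zero) (auto simp: powr_limit_pair_def)
  moreover have "h t = (z + 1) powr (- s) / 2 - (z + 1) powr (1 - s) / (1 - s)
       - periodic_poly sawtooth t * (z + of_real t) powr (- s)
       - s * periodic_powr_integral sawtooth (- s - 1) z t" if "t \<ge> 1" for t
    using hurwitz_partial_sum_euler_maclaurin[OF z s that] by (simp add: h_def z_def)
  ultimately have lim: "mean_limit N h (hurwitz_value K' s z)"
    by (subst mean_limit_cong[where g = "\<lambda>t. (z + 1) powr (- s) / 2 - (z + 1) powr (1 - s) / (1 - s)
       - periodic_poly sawtooth t * (z + of_real t) powr (- s)
       - s * periodic_powr_integral sawtooth (- s - 1) z t"])
       (simp_all add: hurwitz_value_def)
  have int: "(cesaro_mean ^^ k) h integrable_on {0..t}" if "k < N" for k t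
  proof -
    have "Re s < 1" using that by (auto simp: N_def split: if_splits)
    then have "cesaro_regular ((cesaro_mean ^^ k) h)"
      unfolding h_def by (intro cesaro_regular_funpow cesaro_regular_hurwitz_remainder)
    then show ?thesis by (simp add: cesaro_regular_def)
  qed
  have "((cesaro_mean ^^ N) h \<longlongrightarrow> hurwitz_value K' s z) at_top"
    using lim int mean_limit_imp_tail_integrable[OF lim] tail_integrable_continuous[of "\<lambda>_. 0"]
    by (subst cesaro_mean_tail_mean_iff[where f = h and g = "\<lambda>_. 0"]) auto
  with int have "has_cesaro_limit h (hurwitz_value K' s z)"
    unfolding has_cesaro_limit_def by blast
  moreover have "h = (\<lambda>t. hurwitz_partial_sum z s t - power_log_sum [(1 / (1 - s), 1 - s, 0)] (z + of_real t))"
    by (simp add: h_def z_def)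
  moreover have "power_log_terms [(1 / (1 - s), 1 - s, 0)]" using s by (simp add: power_log_terms_def)
  ultimately have "has_remainder_cesaro_sum z s (hurwitz_value K' s z)"
    unfolding has_remainder_cesaro_sum_def by metis
  then show ?thesis
    unfolding hurwitz_zeta_def z_def[symmetric]
    using has_remainder_cesaro_sum_unique[OF z] by blast
qed

section \<open>The antiderivative and its integral\<close>

text \<open>A second primitive of \<open>w\<^bsup>-s\<^esup>\<close>; for \<open>s = 2\<close> the power rule breaks down and a logarithm appears.\<close>

definition powr_second_primitive :: "complex \<Rightarrow> complex \<Rightarrow> complex" where
  "powr_second_primitive s w = (if s = 2 then - Ln w else w powr (2 - s) / ((1 - s) * (2 - s)))"

lemma powr_second_primitive_deriv:
  assumes "Re w > 0" "s \<noteq> 1"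
  shows "(powr_second_primitive s has_field_derivative w powr (1 - s) / (1 - s)) (at w)"
proof -
  have w: "w \<notin> \<real>\<^sub>\<le>\<^sub>0" using assms by (auto simp: complex_nonpos_Reals_iff)
  then have "w \<noteq> 0" by auto
  show ?thesis
  proof (cases "s = 2")
    case True
    have "((\<lambda>w. - Ln w) has_field_derivative - (1 / w)) (at w)"
      using w by (auto intro!: derivative_eq_intros simp: field_simps)
    moreover have "w powr (1 - s) / (1 - s) = - (1 / w)"
      using True \<open>w \<noteq> 0\<close> by (simp add: powr_minus field_simps)
    ultimately show ?thesis using True by (simp add: powr_second_primitive_def[abs_def])
  next
    case False
    have "((\<lambda>w. w powr (2 - s) / ((1 - s) * (2 - s))) has_field_derivative
        (2 - s) * w powr (2 - s - 1) / ((1 - s) * (2 - s))) (at w)"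
      by (rule DERIV_cdivide[OF has_field_derivative_powr[OF w]])
    moreover have "(2 - s) * w powr (2 - s - 1) / ((1 - s) * (2 - s)) = w powr (1 - s) / (1 - s)"
      using False by simp
    ultimately show ?thesis using False by (simp add: powr_second_primitive_def[abs_def])
  qed
qed

text \<open>Integrate by parts on \<open>[0,1]\<close>, where the sawtooth is linear with values \<open>-1/2\<close> and \<open>1/2\<close> at the
  ends.\<close>

lemma unit_powr_integral_sawtooth:
  assumes w: "Re w > 0" and s: "s \<noteq> 1"
  shows "unit_powr_integral sawtooth (- s) w =
     ((w + 1) powr (1 - s) + w powr (1 - s)) / (2 * (1 - s))
     - (powr_second_primitive s (w + 1) - powr_second_primitive s w)"
proof -
  define P where "P = (\<lambda>v::real. (w + of_real v) powr (1 - s) / (1 - s))"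
  define M where "M = (\<lambda>v::real. powr_second_primitive s (w + of_real v))"
  have "((\<lambda>v. of_real (poly sawtooth v) * (w + of_real v) powr (- s)) has_integral
      ((of_real 1 - 1/2) * P 1 - M 1) - ((of_real 0 - 1/2) * P 0 - M 0)) {0..1}"
  proof (rule fundamental_theorem_of_calculus)
    fix v :: real assume v: "v \<in> {0..1}"
    then have wv: "Re (w + of_real v) > 0" using w by simp
    have lin: "((\<lambda>v. w + of_real v) has_vector_derivative 1) (at v)"
      by (auto intro!: derivative_eq_intros)
    have M: "(M has_vector_derivative P v) (at v)"
      using field_vector_diff_chain_at[OF lin powr_second_primitive_deriv[OF wv s]]
      by (simp add: M_def P_def o_def)
    have "((\<lambda>v. 1 / (1 - s) * (w + of_real v) powr (1 - s)) has_vector_derivative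
        1 / (1 - s) * ((1 - s) * (w + of_real v) powr (1 - s - 1))) (at v)"
      using wv by (intro has_vector_derivative_mult_right shift_powr_has_vector_derivative) auto
    then have P: "(P has_vector_derivative (w + of_real v) powr (- s)) (at v)"
      using s by (simp add: P_def[abs_def])
    have "((\<lambda>v. complex_of_real v - 1/2) has_vector_derivative 1) (at v)"
      by (auto intro!: derivative_eq_intros)
    from has_vector_derivative_diff[OF has_vector_derivative_mult[OF this P] M]
    have "((\<lambda>v. (of_real v - 1/2) * P v - M v) has_vector_derivative
        of_real (poly sawtooth v) * (w + of_real v) powr (- s)) (at v)"
      by (simp add: sawtooth_def)
    then show "((\<lambda>v. (of_real v - 1/2) * P v - M v) has_vector_derivative
        of_real (poly sawtooth v) * (w + of_real v) powr (- s)) (at v within {0..1})"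
      by (rule has_vector_derivative_at_within)
  qed simp
  then have "unit_powr_integral sawtooth (- s) w =
      ((of_real 1 - 1/2) * P 1 - M 1) - ((of_real 0 - 1/2) * P 0 - M 0)"
    unfolding unit_powr_integral_def by (rule integral_unique)
  also have "\<dots> = (P 1 + P 0) / 2 - (M 1 - M 0)" by (simp add: field_simps)
  also have "\<dots> = ((w + 1) powr (1 - s) + w powr (1 - s)) / (2 * (1 - s))
     - (powr_second_primitive s (w + 1) - powr_second_primitive s w)"
    by (simp add: P_def M_def add_divide_distrib[symmetric])
  finally show ?thesis .
qed

text \<open>Up to the factor \<open>1 - s\<close> this is the Hurwitz zeta function with \<open>s - 1\<close> in place of \<open>s\<close>.
  It is written out because that function has its pole at \<open>s = 2\<close>, whereas the expression below
  merely acquires a logarithm.\<close>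

definition hurwitz_primitive :: "(complex \<Rightarrow> complex) \<Rightarrow> complex \<Rightarrow> complex \<Rightarrow> complex" where
  "hurwitz_primitive K s z =
     (z + 1) powr (1 - s) / (2 * (1 - s)) - powr_second_primitive s (z + 1) + K z"

lemma hurwitz_primitive_deriv:
  assumes z: "Re z > -1" and s: "s \<noteq> 1" and K: "powr_limit_pair sawtooth (- s) K K'"
  shows "(hurwitz_primitive K s has_field_derivative hurwitz_value K' s z) (at z)"
proof -
  have w: "Re (z + 1) > 0" using z by simp
  then have nz: "z + 1 \<notin> \<real>\<^sub>\<le>\<^sub>0" by (auto simp: complex_nonpos_Reals_iff)
  have 1: "((\<lambda>z. (z + 1) powr (1 - s)) has_field_derivative (1 - s) * (z + 1) powr (1 - s - 1)) (at z)"
    using has_field_derivative_powr[OF nz, of "1 - s"] by (subst (asm) DERIV_shift)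
  have 2: "((\<lambda>z. powr_second_primitive s (z + 1)) has_field_derivative (z + 1) powr (1 - s) / (1 - s)) (at z)"
    using powr_second_primitive_deriv[OF w s] by (subst (asm) DERIV_shift)
  have 3: "(K has_field_derivative - s * K' z) (at z)"
    using K z by (auto simp: powr_limit_pair_def)
  have "(hurwitz_primitive K s has_field_derivative
      (1 - s) * (z + 1) powr (1 - s - 1) / (2 * (1 - s)) - (z + 1) powr (1 - s) / (1 - s) + - s * K' z) (at z)"
    unfolding hurwitz_primitive_def[abs_def]
    by (rule DERIV_add[OF DERIV_diff[OF DERIV_cdivide[OF 1] 2] 3])
  also have "(1 - s) * (z + 1) powr (1 - s - 1) / (2 * (1 - s)) - (z + 1) powr (1 - s) / (1 - s) + - s * K' z
      = hurwitz_value K' s z"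
  proof -
    have "r * q / (2 * r) = q / 2" if "r \<noteq> 0" for r q :: complex using that by simp
    from this[of "1 - s"] show ?thesis using s by (simp only: hurwitz_value_def) simp
  qed
  finally show ?thesis .
qed

text \<open>The counterpart of \<open>\<zeta>\<^sub>H(w - 1; s - 1) = w\<^bsup>1-s\<^esup> + \<zeta>\<^sub>H(w; s - 1)\<close>. The antiderivative satisfies it
  without a further constant of integration, and this is why the integral vanishes.\<close>

lemma hurwitz_primitive_shift:
  assumes w: "Re w > 0" and s: "s \<noteq> 1" and K: "powr_limit_pair sawtooth (- s) K K'"
  shows "hurwitz_primitive K s (w - 1) = w powr (1 - s) / (1 - s) + hurwitz_primitive K s w"
proof -
  have "K (w - 1) = unit_powr_integral sawtooth (- s) w + K w"
    using K w by (auto simp: powr_limit_pair_def)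
  then have "hurwitz_primitive K s (w - 1) - hurwitz_primitive K s w =
      w powr (1 - s) / (2 * (1 - s)) + w powr (1 - s) / (2 * (1 - s))"
    unfolding hurwitz_primitive_def unit_powr_integral_sawtooth[OF w s]
    by (simp add: add_divide_distrib)
  also have "\<dots> = w powr (1 - s) / (1 - s)"
  proof -
    have "q / (2 * r) + q / (2 * r) = q / r" for r q :: complex
      by (cases "r = 0") (simp_all add: field_simps)
    then show ?thesis .
  qed
  finally show ?thesis by (simp add: algebra_simps)
qed

theorem mainTheorem4:
  fixes s :: complex
  assumes "s \<noteq> 1"
  shows "(Re s < 1 \<longrightarrow> ((\<lambda>x::real. hurwitz_zeta (complex_of_real x) s) has_integral 0) {-1..0})
       \<and> has_remainder_integral (\<lambda>x::real. hurwitz_zeta (complex_of_real x) s) 0 (-1) 0"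
proof -
  let ?f = "\<lambda>x::real. hurwitz_zeta (complex_of_real x) s"
  obtain M where "Re (- s) + 1 < real M" using reals_Archimedean2 by blast
  from powr_limit_pair_exists[OF sawtooth_mean_zero this]
  obtain K K' where K: "powr_limit_pair sawtooth (- s) K K'" by blast
  define A where "A = (\<lambda>x::real. hurwitz_primitive K s (of_real x))"
  have deriv: "(A has_vector_derivative ?f x) (at x)" if "x > -1" for x
  proof -
    have "(complex_of_real has_vector_derivative 1) (at x)" by (auto intro!: derivative_eq_intros)
    from field_vector_diff_chain_at[OF this hurwitz_primitive_deriv[OF _ assms K]] that
    show ?thesis by (simp add: A_def o_def hurwitz_zeta_eq[OF that assms K])
  qed
  have shift: "A (x - 1) = of_real x powr (1 - s) / (1 - s) + A x" if "x > 0" for x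
    using hurwitz_primitive_shift[of "of_real x" s K K'] that assms K by (simp add: A_def)
  have int: "(?f has_integral (A 0 - A (\<epsilon> - 1))) {-1 + \<epsilon>..0}" if "0 < \<epsilon>" "\<epsilon> < 1" for \<epsilon>
  proof -
    have "(?f has_integral (A 0 - A (-1 + \<epsilon>))) {-1 + \<epsilon>..0}"
      using that by (intro fundamental_theorem_of_calculus)
        (auto intro!: has_vector_derivative_at_within[OF deriv])
    then show ?thesis by (simp add: add.commute)
  qed
  have cont: "isCont A x" if "x > -1" for x
    by (rule has_vector_derivative_continuous[OF deriv[OF that]])
  have "has_remainder_integral ?f 0 (-1) 0"
    unfolding has_remainder_integral_def
  proof (intro conjI allI impI exI[of _ "[(- 1 / (1 - s), 1 - s, 0)]"])
    fix \<epsilon> :: real assume "0 < \<epsilon> \<and> \<epsilon> < 0 - (-1)"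
    then show "?f integrable_on {-1 + \<epsilon>..0}" using int[of \<epsilon>] by auto
  next
    show "power_log_terms [(- 1 / (1 - s), 1 - s, 0)]" using assms by (simp add: power_log_terms_def)
    have "((\<lambda>\<epsilon>. A 0 - A \<epsilon>) \<longlongrightarrow> A 0 - A 0) (at_right 0)"
      using cont[of 0] by (intro tendsto_intros) (auto simp: isCont_def intro: tendsto_within_subset)
    moreover have "A 0 - A \<epsilon> = integral {-1 + \<epsilon>..0} ?f
        - power_log_sum [(- 1 / (1 - s), 1 - s, 0)] (complex_of_real \<epsilon>)" if "0 < \<epsilon>" "\<epsilon> < 1" for \<epsilon>
      unfolding integral_unique[OF int[OF that]] shift[OF that(1)] by simp
    then have "eventually (\<lambda>\<epsilon>. A 0 - A \<epsilon> = integral {-1 + \<epsilon>..0} ?f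
        - power_log_sum [(- 1 / (1 - s), 1 - s, 0)] (complex_of_real \<epsilon>)) (at_right 0)"
      unfolding eventually_at_right_field by (intro exI[of _ 1]) simp
    ultimately show "((\<lambda>\<epsilon>. integral {-1 + \<epsilon>..0} ?f
        - power_log_sum [(- 1 / (1 - s), 1 - s, 0)] (complex_of_real \<epsilon>)) \<longlongrightarrow> 0) (at_right 0)"
      using Lim_transform_eventually by force
  qed
  moreover have "(?f has_integral 0) {-1..0}" if s: "Re s < 1"
  proof -
    \<comment> \<open>By the shift relation \<open>B\<close> is \<open>A\<close>, rewritten so that it is continuous up to \<open>-1\<close>.\<close>
    define B where "B = (\<lambda>x::real. of_real (x + 1) powr (1 - s) / (1 - s) + A (x + 1))"
    have B: "B x = A x" if "x > -1" for x using shift[of "x + 1"] that by (simp add: B_def)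
    have "(?f has_integral (B 0 - B (-1))) {-1..0}"
    proof (rule fundamental_theorem_of_calculus_interior)
      have "continuous_on {-1..0} (\<lambda>x. complex_of_real (x + 1) powr (1 - s))"
        using s by (intro continuous_on_compose2[OF continuous_on_real_powr[of "1 - s" UNIV]] continuous_intros) auto
      moreover have "continuous_on {-1..0} (\<lambda>x. A (x + 1))"
        using cont
        by (intro continuous_on_compose2[of "{-1<..}" A _ "\<lambda>x. x + 1"] continuous_at_imp_continuous_on
            continuous_intros) auto
      ultimately show "continuous_on {-1..0} B"
        unfolding B_def using assms by (intro continuous_on_add continuous_on_divide) auto
    next
      fix x :: real assume x: "x \<in> {-1<..<0}"
      then show "(B has_vector_derivative ?f x) (at x)"
        using B by (intro has_vector_derivative_transform_within_open[OF deriv, of x "{-1<..}"]) auto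
    qed simp
    moreover have "B 0 = A 0" "B (-1) = A 0" using B[of 0] assms by (simp_all add: B_def)
    ultimately show ?thesis by simp
  qed
  ultimately show ?thesis by blast
qed

end
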